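(* Let $G$ be a Berge graph, let $X\subseteq V(G)$ be nonempty and anticonnected, and let $P$ be a path or hole in $G\setminus X$ having at least three $X$-complete vertices. If $Q$ is a subpath of $P$ whose two ends are $X$-complete, then the number of $X$-complete edges of $Q$ has the same parity as the length of $Q$. Consequently, for every hole $C$ of $G\setminus X$, either $C$ has an even number of $X$-complete edges, or $C$ has exactly two $X$-complete vertices and they are adjacent.
   Context: Graphs are finite and simple. Hole: induced cycle of length $\ge 4$; antihole: induced subgraph whose complement is a hole; $G$ is Berge if all holes and antiholes have even length. A path means an induced subgraph that is a path; its length is its number of edges. $X$ is anticonnected if the complement of $G|X$ is connected. A vertex is $X$-complete if adjacent to all of $X$; an edge is $X$-complete if both ends are. *)

theory Defs
  imports Main
begin

definition graph :: "'a set \<Rightarrow> ('a \<Rightarrow> 'a \<Rightarrow> bool) \<Rightarrow> bool" where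
  "graph V E \<longleftrightarrow> finite V \<and> (\<forall>x y. E x y \<longrightarrow> E y x) \<and> (\<forall>x. \<not> E x x)
     \<and> (\<forall>x y. E x y \<longrightarrow> x \<in> V \<and> y \<in> V)"

text \<open>An induced path in the graph on vertex set V, given by its vertex sequence;
  its length is  length p - 1  (number of edges).\<close>
definition is_path :: "'a set \<Rightarrow> ('a \<Rightarrow> 'a \<Rightarrow> bool) \<Rightarrow> 'a list \<Rightarrow> bool" where
  "is_path V E p \<longleftrightarrow> p \<noteq> [] \<and> distinct p \<and> set p \<subseteq> V \<and>
     (\<forall>i < length p. \<forall>j < length p. E (p!i) (p!j) \<longleftrightarrow> (i + 1 = j \<or> j + 1 = i))"

definition is_hole :: "'a set \<Rightarrow> ('a \<Rightarrow> 'a \<Rightarrow> bool) \<Rightarrow> 'a list \<Rightarrow> bool" where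
  "is_hole V E c \<longleftrightarrow> length c \<ge> 4 \<and> distinct c \<and> set c \<subseteq> V \<and>
     (\<forall>i < length c. \<forall>j < length c.
        E (c!i) (c!j) \<longleftrightarrow> (j = (i + 1) mod length c \<or> i = (j + 1) mod length c))"

definition is_antihole :: "'a set \<Rightarrow> ('a \<Rightarrow> 'a \<Rightarrow> bool) \<Rightarrow> 'a list \<Rightarrow> bool" where
  "is_antihole V E c \<longleftrightarrow> is_hole V (\<lambda>x y. x \<noteq> y \<and> \<not> E x y) c"

definition berge :: "'a set \<Rightarrow> ('a \<Rightarrow> 'a \<Rightarrow> bool) \<Rightarrow> bool" where
  "berge V E \<longleftrightarrow> (\<forall>c. (is_hole V E c \<or> is_antihole V E c) \<longrightarrow> even (length c))"

definition connected_on :: "'a set \<Rightarrow> ('a \<Rightarrow> 'a \<Rightarrow> bool) \<Rightarrow> bool" where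
  "connected_on S R \<longleftrightarrow> (\<forall>x\<in>S. \<forall>y\<in>S. (\<lambda>a b. a \<in> S \<and> b \<in> S \<and> R a b)\<^sup>*\<^sup>* x y)"

definition anticonnected :: "('a \<Rightarrow> 'a \<Rightarrow> bool) \<Rightarrow> 'a set \<Rightarrow> bool" where
  "anticonnected E X \<longleftrightarrow> connected_on X (\<lambda>a b. a \<noteq> b \<and> \<not> E a b)"

definition complete :: "('a \<Rightarrow> 'a \<Rightarrow> bool) \<Rightarrow> 'a set \<Rightarrow> 'a \<Rightarrow> bool" where
  "complete E X v \<longleftrightarrow> (\<forall>x\<in>X. E v x)"

definition path_complete_edges :: "('a \<Rightarrow> 'a \<Rightarrow> bool) \<Rightarrow> 'a set \<Rightarrow> 'a list \<Rightarrow> nat" where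
  "path_complete_edges E X p =
     card {i. i + 1 < length p \<and> complete E X (p!i) \<and> complete E X (p!(i+1))}"

definition hole_complete_edges :: "('a \<Rightarrow> 'a \<Rightarrow> bool) \<Rightarrow> 'a set \<Rightarrow> 'a list \<Rightarrow> nat" where
  "hole_complete_edges E X c =
     card {i. i < length c \<and> complete E X (c!i) \<and> complete E X (c!((i+1) mod length c))}"

end

theory Submission
  imports Defs
begin

text \<open>The statement reduces to the following. Let \<open>p\<close> be a path with complete ends, incomplete interior
  and at least three vertices, and let \<open>v\<close> be a further complete vertex without neighbours in the
  interior of \<open>p\<close>; then \<open>p\<close> has even length. (In a path or hole with three complete vertices, cut \<open>Q\<close>
  at its complete vertices; a third complete vertex serves as \<open>v\<close> since degrees are at most two.)
  This is a form of the Roussel--Rubio lemma, and the presence of \<open>v\<close> allows a short proof by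
  induction on \<open>X\<close>: if \<open>p\<close> had odd length, then by induction it would have an odd number of
  \<open>S\<close>-complete edges for every nonempty anticonnected proper subset \<open>S\<close> of \<open>X\<close>. If \<open>X\<close> is stable, all
  subsets are available and inclusion--exclusion contradicts the parity of the gaps between
  neighbours of \<open>X\<close>. Otherwise some adjacent \<open>x\<close>, \<open>y\<close> in \<open>X\<close> can be deleted keeping \<open>X\<close> anticonnected, and
  the parities for \<open>X - {x}\<close>, \<open>X - {y}\<close> and \<open>X - {x, y}\<close> clash with the antiholes through an antipath
  from \<open>x\<close> to \<open>y\<close>.\<close>

section \<open>Induced paths and holes\<close>

lemma is_pathI:
  assumes "p \<noteq> []" "distinct p" "set p \<subseteq> V"
    and "\<And>i j. i < length p \<Longrightarrow> j < length p \<Longrightarrow> E (p!i) (p!j) \<longleftrightarrow> (i + 1 = j \<or> j + 1 = i)"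
  shows "is_path V E p"
  using assms unfolding is_path_def by blast

lemma is_pathD:
  assumes "is_path V E p"
  shows "p \<noteq> []" "distinct p" "set p \<subseteq> V"
    and "\<And>i j. i < length p \<Longrightarrow> j < length p \<Longrightarrow> E (p!i) (p!j) \<longleftrightarrow> (i + 1 = j \<or> j + 1 = i)"
  using assms unfolding is_path_def by blast+

lemma is_path_mono: "is_path V E p \<Longrightarrow> set p \<subseteq> W \<Longrightarrow> is_path W E p"
  unfolding is_path_def by blast

text \<open>The adjacency \<open>R\<close> is arbitrary so that the same facts serve paths and holes
  of the graph, with \<open>E\<close>, and antipaths and antiholes, with the complement
  \<open>H\<close>.\<close>

lemma is_path_Cons:
  assumes p: "is_path V R p" and sym: "\<And>x y. R x y \<Longrightarrow> R y x" and irr: "\<And>x. \<not> R x x"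
    and z: "z \<in> V" "z \<notin> set p" and adj: "\<And>u. u \<in> set p \<Longrightarrow> R z u \<longleftrightarrow> u = hd p"
  shows "is_path V R (z # p)"
proof (rule is_pathI)
  note P = is_pathD[OF p]
  show "z # p \<noteq> []" "distinct (z # p)" "set (z # p) \<subseteq> V" using P(2,3) z by auto
  have z_adj: "R z (p!k) \<longleftrightarrow> k = 0" if "k < length p" for k
    using that P(1,2) adj[of "p!k"] by (simp add: hd_conv_nth nth_eq_iff_index_eq)
  have z_adj': "R (p!k) z \<longleftrightarrow> k = 0" if "k < length p" for k
    using z_adj[OF that] sym by blast
  fix i j assume ij: "i < length (z # p)" "j < length (z # p)"
  show "R ((z # p)!i) ((z # p)!j) \<longleftrightarrow> (i + 1 = j \<or> j + 1 = i)"
  proof (cases i; cases j)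
    fix k assume "i = 0" "j = Suc k"
    then show ?thesis using ij z_adj[of k] by auto
  next
    fix k assume "i = Suc k" "j = 0"
    then show ?thesis using ij z_adj'[of k] by auto
  next
    fix k l assume "i = Suc k" "j = Suc l"
    then show ?thesis using ij P(4)[of k l] by auto
  qed (use irr in auto)
qed

lemma is_path_rev:
  assumes p: "is_path V R p"
  shows "is_path V R (rev p)"
proof (rule is_pathI)
  note P = is_pathD[OF p]
  show "rev p \<noteq> []" "distinct (rev p)" "set (rev p) \<subseteq> V" using P(1-3) by auto
  fix i j assume "i < length (rev p)" "j < length (rev p)"
  then show "R (rev p ! i) (rev p ! j) \<longleftrightarrow> (i + 1 = j \<or> j + 1 = i)"
    using P(4)[of "length p - Suc i" "length p - Suc j"] by (auto simp: rev_nth)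
qed

lemma is_path_snoc:
  assumes p: "is_path V R p" and sym: "\<And>x y. R x y \<Longrightarrow> R y x" and irr: "\<And>x. \<not> R x x"
    and z: "z \<in> V" "z \<notin> set p" and adj: "\<And>u. u \<in> set p \<Longrightarrow> R z u \<longleftrightarrow> u = last p"
  shows "is_path V R (p @ [z])"
proof -
  have "is_path V R (z # rev p)"
    using is_path_Cons[OF is_path_rev[OF p] sym irr z(1)] z(2) adj is_pathD(1)[OF p]
    by (simp add: hd_rev)
  from is_path_rev[OF this] show ?thesis by simp
qed

lemma is_hole_Cons:
  assumes p: "is_path V R p" and sym: "\<And>x y. R x y \<Longrightarrow> R y x" and irr: "\<And>x. \<not> R x x"
    and len: "3 \<le> length p" and z: "z \<in> V" "z \<notin> set p"
    and adj: "\<And>u. u \<in> set p \<Longrightarrow> R z u \<longleftrightarrow> u = hd p \<or> u = last p"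
  shows "is_hole V R (z # p)"
proof -
  note P = is_pathD[OF p]
  have z_adj: "R z (p!k) \<longleftrightarrow> k = 0 \<or> Suc k = length p" if "k < length p" for k
  proof -
    have "p!k = hd p \<longleftrightarrow> k = 0" "p!k = last p \<longleftrightarrow> k = length p - 1"
      using that P(1,2) by (simp_all add: hd_conv_nth last_conv_nth nth_eq_iff_index_eq)
    then show ?thesis using adj[of "p!k"] that by auto
  qed
  \<comment> \<open>Replacing the modulus by a case distinction leaves only linear arithmetic on
    positions.\<close>
  have md: "(k + 1) mod length (z # p) = (if k = length p then 0 else k + 1)"
    if "k < length (z # p)" for k
    using that by (cases "k = length p") simp_all
  have "R ((z # p)!i) ((z # p)!j) \<longleftrightarrow>
      (j = (i + 1) mod length (z # p) \<or> i = (j + 1) mod length (z # p))"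
    if ij: "i < length (z # p)" "j < length (z # p)" for i j
  proof -
    have z_adj': "R (p!k) z \<longleftrightarrow> k = 0 \<or> Suc k = length p" if "k < length p" for k
      using z_adj[OF that] sym by blast
    have "R ((z # p)!i) ((z # p)!j) \<longleftrightarrow> (j = (if i = length p then 0 else i + 1)
        \<or> i = (if j = length p then 0 else j + 1))" (is ?goal)
    proof (cases i; cases j)
      fix k assume "i = 0" "j = Suc k"
      then show ?goal
        using ij z_adj[of k] by auto
    next
      fix k assume "i = Suc k" "j = 0"
      then show ?goal
        using ij z_adj'[of k] by auto
    next
      fix k l assume kl: "i = Suc k" "j = Suc l"
      then have "R ((z # p)!i) ((z # p)!j) \<longleftrightarrow> (k + 1 = l \<or> l + 1 = k)"
        using ij P(4)[of k l] by simp
      moreover have "(k + 1 = l \<or> l + 1 = k) \<longleftrightarrow> (j = (if i = length p then 0 else i + 1)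
          \<or> i = (if j = length p then 0 else j + 1))"
        using ij unfolding kl by auto
      ultimately show ?goal by (simp only:)
    next
      assume "i = 0" "j = 0"
      moreover have "length p \<noteq> 0" using len by linarith
      ultimately show ?goal using irr by simp
    qed
    then show ?thesis unfolding md[OF ij(1)] md[OF ij(2)] .
  qed
  then show ?thesis unfolding is_hole_def using P(2,3) z len by simp
qed

text \<open>Both end positions are included, so a slice of a path has \<open>j - i\<close> edges and
  \<open>Suc j - i\<close> vertices.\<close>

definition slice :: "'a list \<Rightarrow> nat \<Rightarrow> nat \<Rightarrow> 'a list" where
  "slice p i j = take (Suc j - i) (drop i p)"

lemma length_slice: "i \<le> j \<Longrightarrow> j < length p \<Longrightarrow> length (slice p i j) = Suc j - i"
  by (simp add: slice_def)

lemma nth_slice: "i \<le> j \<Longrightarrow> j < length p \<Longrightarrow> k < Suc j - i \<Longrightarrow> slice p i j ! k = p ! (i + k)"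
  by (simp add: slice_def)

lemma set_slice: "i \<le> j \<Longrightarrow> j < length p \<Longrightarrow> set (slice p i j) = (!) p ` {i..j}"
proof -
  assume ij: "i \<le> j" "j < length p"
  have "set (slice p i j) = (\<lambda>k. slice p i j ! k) ` {..<Suc j - i}"
    using length_slice[OF ij] by (metis atLeast0LessThan list.set_map map_nth set_upt)
  also have "\<dots> = (\<lambda>k. p ! (i + k)) ` {..<Suc j - i}"
    using nth_slice[OF ij] by (intro image_cong) auto
  also have "\<dots> = (!) p ` ((+) i ` {..<Suc j - i})" by (simp add: image_image)
  also have "(+) i ` {..<Suc j - i} = {i..j}"
  proof -
    have "x \<in> (+) i ` {..<Suc j - i}" if "x \<in> {i..j}" for x
      using that by (intro image_eqI[of _ _ "x - i"]) auto
    then show ?thesis by auto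
  qed
  finally show ?thesis .
qed

lemma hd_slice: "i \<le> j \<Longrightarrow> j < length p \<Longrightarrow> hd (slice p i j) = p ! i"
  using length_slice[of i j p] nth_slice[of i j p 0] by (cases "slice p i j") (auto simp: hd_conv_nth)

lemma last_slice: "i \<le> j \<Longrightarrow> j < length p \<Longrightarrow> last (slice p i j) = p ! j"
  using length_slice[of i j p] nth_slice[of i j p "j - i"]
  by (cases "slice p i j = []") (auto simp: last_conv_nth)

lemma is_path_slice:
  assumes p: "is_path V R p" and ij: "i \<le> j" "j < length p"
  shows "is_path V R (slice p i j)"
proof (rule is_pathI)
  note P = is_pathD[OF p]
  show "slice p i j \<noteq> []" using length_slice[OF ij] ij by auto
  show "distinct (slice p i j)" using P(2) by (simp add: slice_def)
  show "set (slice p i j) \<subseteq> V" using P(3) set_take_subset set_drop_subset unfolding slice_def by fast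
  fix k l assume "k < length (slice p i j)" "l < length (slice p i j)"
  then show "R (slice p i j ! k) (slice p i j ! l) \<longleftrightarrow> (k + 1 = l \<or> l + 1 = k)"
    using ij P(4)[of "i + k" "i + l"] by (auto simp: length_slice nth_slice)
qed

text \<open>Induction along a walk from \<open>x\<close>, keeping an induced path to the current
  vertex. If the next vertex already lies on the path, the path is cut there; otherwise it is cut at
  the first neighbour of the new vertex.\<close>

lemma induced_path_exists:
  assumes sym: "\<And>x y. R x y \<Longrightarrow> R y x" and irr: "\<And>x. \<not> R x x"
    and conn: "connected_on S R" and xy: "x \<in> S" "y \<in> S"
  shows "\<exists>q. is_path S R q \<and> hd q = x \<and> last q = y"
proof -
  have "(\<lambda>a b. a \<in> S \<and> b \<in> S \<and> R a b)\<^sup>*\<^sup>* x y" using conn xy unfolding connected_on_def by blast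
  then show ?thesis
  proof (induction rule: rtranclp_induct)
    case base
    have "is_path S R [x]" using xy irr by (auto simp: is_path_def)
    then show ?case by force
  next
    case (step y z)
    then obtain q where q: "is_path S R q" "hd q = x" "last q = y" by blast
    note Q = is_pathD[OF q(1)]
    show ?case
    proof (cases "z \<in> set q")
      case True
      then obtain k where k: "k < length q" "q ! k = z" by (auto simp: in_set_conv_nth)
      have "is_path S R (slice q 0 k)" "hd (slice q 0 k) = x" "last (slice q 0 k) = z"
        using is_path_slice[OF q(1), of 0 k] hd_slice[of 0 k q] last_slice[of 0 k q] k q(2) Q(1)
        by (auto simp: hd_conv_nth)
      then show ?thesis by blast
    next
      case False
      \<comment> \<open>Cutting at the first neighbour of \<open>z\<close> makes the last vertex of
        the remaining segment the only one adjacent to \<open>z\<close>, so the extension stays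
        induced.\<close>
      define k where "k = (LEAST k. k < length q \<and> R (q!k) z)"
      have "\<exists>k. k < length q \<and> R (q!k) z"
        using step(2) q(3) Q(1) by (intro exI[of _ "length q - 1"]) (auto simp: last_conv_nth)
      from LeastI_ex[OF this] have k: "k < length q" "R (q!k) z"
        unfolding k_def by blast+
      have least: "\<not> R (q!l) z" if "l < k" for l
        using that not_less_Least[of l "\<lambda>k. k < length q \<and> R (q!k) z"] k(1)
        unfolding k_def[symmetric] by simp
      let ?s = "slice q 0 k"
      have s: "is_path S R ?s" "hd ?s = x" "last ?s = q!k" "set ?s = (!) q ` {0..k}"
        using is_path_slice[OF q(1), of 0 k] hd_slice[of 0 k q] last_slice[of 0 k q]
          set_slice[of 0 k q] k q(2) Q(1)
        by (auto simp: hd_conv_nth)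
      have "is_path S R (?s @ [z])"
      proof (rule is_path_snoc[OF s(1) sym irr])
        show "z \<in> S" using step by simp
        show "z \<notin> set ?s" using False s(4) k(1) by auto
        fix u assume "u \<in> set ?s"
        then obtain l where l: "l \<le> k" "u = q!l" using s(4) by auto
        show "R z u \<longleftrightarrow> u = last ?s"
        proof (cases "l = k")
          case True then show ?thesis using l k sym s(3) by auto
        next
          case False
          then have "\<not> R z u" using l least[of l] sym by auto
          moreover have "u \<noteq> q!k"
            using False l k(1) Q(2) by (simp add: nth_eq_iff_index_eq)
          ultimately show ?thesis using s(3) by auto
        qed
      qed
      moreover have "hd (?s @ [z]) = x" using s(1,2) is_pathD(1) by (metis hd_append2)
      ultimately show ?thesis by (metis last_snoc)
    qed
  qed
qed

section \<open>Vertices that do not disconnect\<close>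

lemma connected_on_insert:
  assumes conn: "connected_on C R" and sym: "\<And>x y. R x y \<Longrightarrow> R y x" and c: "c \<in> C" "R c w"
  shows "connected_on (insert w C) R"
proof -
  let ?r = "\<lambda>a b. a \<in> insert w C \<and> b \<in> insert w C \<and> R a b"
  have mono: "?r\<^sup>*\<^sup>* x y" if "x \<in> C" "y \<in> C" for x y
    using conn that mono_rtranclp[of "\<lambda>a b. a \<in> C \<and> b \<in> C \<and> R a b" ?r]
    unfolding connected_on_def by blast
  have "?r\<^sup>*\<^sup>* x c" "?r\<^sup>*\<^sup>* c x" if "x \<in> insert w C" for x
    using that mono[of x c] mono[of c x] c sym
    by (auto intro: r_into_rtranclp)
  then show ?thesis unfolding connected_on_def by (meson rtranclp_trans)
qed

lemma connected_on_boundary: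
  assumes conn: "connected_on S R" and C: "C \<noteq> {}" "C \<subset> S"
  shows "\<exists>c\<in>C. \<exists>w\<in>S - C. R c w"
proof (rule ccontr)
  assume no: "\<not> ?thesis"
  obtain c w where cw: "c \<in> C" "w \<in> S - C" using C by blast
  have "(\<lambda>a b. a \<in> S \<and> b \<in> S \<and> R a b)\<^sup>*\<^sup>* c w"
    using conn cw C unfolding connected_on_def by blast
  then have "w \<in> C" by (induction rule: rtranclp_induct) (use no cw in auto)
  then show False using cw by simp
qed

text \<open>A maximal connected proper subset \<open>D\<close> of \<open>S\<close> containing
  \<open>C\<close> can be enlarged by a neighbouring vertex. By maximality that vertex is all that
  \<open>D\<close> misses, so deleting it leaves the connected set \<open>D\<close>.\<close>

lemma non_cut_vertex_outside:
  assumes fin: "finite S" and conn: "connected_on S R" and sym: "\<And>x y. R x y \<Longrightarrow> R y x"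
    and C: "C \<noteq> {}" "C \<subset> S" "connected_on C R"
  shows "\<exists>u\<in>S - C. connected_on (S - {u}) R"
proof -
  define F where "F = {D. C \<subseteq> D \<and> D \<subset> S \<and> connected_on D R}"
  have "F \<subseteq> Pow S" unfolding F_def by blast
  then have "finite F" using fin finite_subset by blast
  moreover have "C \<in> F" unfolding F_def using C by blast
  ultimately obtain D where D: "D \<in> F" and mx: "\<forall>D'\<in>F. D \<subseteq> D' \<longrightarrow> D = D'"
    using finite_has_maximal2[of F C] by auto
  have D': "C \<subseteq> D" "D \<subset> S" "connected_on D R" "D \<noteq> {}" using D C unfolding F_def by auto
  obtain c w where cw: "c \<in> D" "w \<in> S" "w \<notin> D" "R c w"
    using connected_on_boundary[OF conn D'(4,2)] by blast
  have conn': "connected_on (insert w D) R" using connected_on_insert[OF D'(3) sym cw(1,4)] by simp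
  have "insert w D = S"
  proof (rule ccontr)
    assume "insert w D \<noteq> S"
    then have "insert w D \<in> F" unfolding F_def using conn' D' cw by blast
    then show False using mx cw(3) by blast
  qed
  then have "S - {w} = D" using cw(3) by blast
  then show ?thesis using D' cw by blast
qed

lemma connected_on_star:
  assumes sym: "\<And>x y. R x y \<Longrightarrow> R y x" and c: "c \<in> S" "\<And>u. u \<in> S \<Longrightarrow> u \<noteq> c \<Longrightarrow> R c u"
  shows "connected_on S R"
proof -
  let ?r = "\<lambda>a b. a \<in> S \<and> b \<in> S \<and> R a b"
  have "?r\<^sup>*\<^sup>* x c" "?r\<^sup>*\<^sup>* c x" if "x \<in> S" for x
    using that c sym by (cases "x = c"; auto intro: r_into_rtranclp)+
  then show ?thesis unfolding connected_on_def by (meson rtranclp_trans)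
qed

text \<open>One vertex \<open>u\<close> that does not disconnect is adjacent to all others, by the
  hypothesis \<open>adj\<close>. After the deletion of any other vertex a star around
  \<open>u\<close> still connects the rest, so no vertex disconnects and \<open>adj\<close> applies
  to every pair.\<close>

lemma non_cut_vertices_adjacent_imp_clique:
  assumes fin: "finite S" and conn: "connected_on S R" and sym: "\<And>x y. R x y \<Longrightarrow> R y x"
    and adj: "\<And>u w. u \<in> S \<Longrightarrow> w \<in> S \<Longrightarrow> u \<noteq> w \<Longrightarrow> connected_on (S - {u}) R
      \<Longrightarrow> connected_on (S - {w}) R \<Longrightarrow> R u w"
  shows "\<forall>u\<in>S. connected_on (S - {u}) R" and "\<forall>u\<in>S. \<forall>w\<in>S. u \<noteq> w \<longrightarrow> R u w"
proof -
  show non_cut: "\<forall>u\<in>S. connected_on (S - {u}) R"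
  proof
    fix w assume w: "w \<in> S"
    have emp: "connected_on {} R" by (simp add: connected_on_def)
    obtain u where u: "u \<in> S" "connected_on (S - {u}) R"
    proof (cases "S = {w}")
      case True then show ?thesis using that[of w] emp by simp
    next
      case False
      then show ?thesis
        using non_cut_vertex_outside[OF fin conn sym, of "{w}"] that w
        by (auto simp: connected_on_def)
    qed
    have univ: "R u t" if "t \<in> S" "t \<noteq> u" for t
    proof (rule ccontr)
      assume "\<not> R u t"
      \<comment> \<open>If \<open>u\<close> had a nonneighbour, its closed neighbourhood would be a
        connected proper subset, and some vertex outside it would not disconnect \<open>S\<close>;
        \<open>adj\<close> makes that vertex a neighbour of \<open>u\<close>, which is
        absurd.\<close>
      let ?C = "{s \<in> S. s = u \<or> R u s}"
      have "connected_on ?C R" by (rule connected_on_star[where c = u, OF sym]) (use u in auto)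
      moreover have "?C \<noteq> {}" using u by blast
      moreover have "?C \<subset> S" using that \<open>\<not> R u t\<close> by blast
      ultimately obtain s where "s \<in> S - ?C" "connected_on (S - {s}) R"
        using non_cut_vertex_outside[OF fin conn sym] by meson
      then show False using adj[of u s] u by blast
    qed
    show "connected_on (S - {w}) R"
    proof (cases "w = u")
      case False
      then show ?thesis by (intro connected_on_star[where c = u, OF sym]) (use u univ in auto)
    qed (use u in simp)
  qed
  then show "\<forall>u\<in>S. \<forall>w\<in>S. u \<noteq> w \<longrightarrow> R u w" using adj by blast
qed

text \<open>Applied with the complement as \<open>R\<close>, so that the pair found is adjacent in
  the graph. Fix \<open>x\<close> not disconnecting \<open>S\<close>, and let \<open>?U\<close>
  consist of the vertices not disconnecting \<open>S - {x}\<close>. A nonneighbour \<open>y\<close>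
  of \<open>x\<close> in \<open>?U\<close> gives the first alternative. If all of \<open>?U\<close>
  is adjacent to \<open>x\<close>, then \<open>?U\<close> contains a nonadjacent pair, since
  otherwise \<open>S\<close> would be a clique; this pair has \<open>x\<close> as common
  neighbour.\<close>

lemma separated_non_cut_pair:
  assumes fin: "finite S" and conn: "connected_on S R" and sym: "\<And>x y. R x y \<Longrightarrow> R y x"
    and irr: "\<And>x. \<not> R x x" and non_clique: "\<exists>u\<in>S. \<exists>w\<in>S. u \<noteq> w \<and> \<not> R u w"
  shows "\<exists>x\<in>S. \<exists>y\<in>S. x \<noteq> y \<and> \<not> R x y \<and> connected_on (S - {x}) R \<and> connected_on (S - {y}) R
    \<and> (connected_on (S - {x, y}) R \<or> (\<exists>c\<in>S. R x c \<and> R c y))"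
proof -
  obtain x where x: "x \<in> S" "connected_on (S - {x}) R"
  proof -
    obtain a b where "a \<in> S" "b \<in> S" "a \<noteq> b" using non_clique by blast
    then show ?thesis
      using non_cut_vertex_outside[OF fin conn sym, of "{a}"] that by (auto simp: connected_on_def)
  qed
  have fin': "finite (S - {x})" using fin by simp
  have dd: "S - {x} - {u} = S - {x, u}" "S - {u} = insert x (S - {x, u})" if "u \<noteq> x" for u
    using that x by auto
  \<comment> \<open>Putting \<open>x\<close> back keeps the set connected as long as some neighbour
    \<open>s\<close> of \<open>x\<close> survives the deletion of \<open>u\<close>.\<close>
  have extend: "connected_on (S - {u}) R"
    if "u \<in> S" "u \<noteq> x" "connected_on (S - {x} - {u}) R" "s \<in> S" "s \<noteq> u" "R x s" for u s
  proof -
    have "s \<noteq> x" using that irr by metis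
    then show ?thesis
      using connected_on_insert[OF that(3) sym, of s x] that dd[of u] sym by auto
  qed
  let ?U = "{u \<in> S - {x}. connected_on (S - {x} - {u}) R}"
  show ?thesis
  proof (cases "\<exists>y\<in>?U. \<not> R x y")
    case True
    then obtain y where y: "y \<in> S" "y \<noteq> x" "connected_on (S - {x} - {y}) R" "\<not> R x y" by blast
    obtain s where "s \<in> S" "R x s"
      using connected_on_boundary[OF conn, of "{x}"] x y by blast
    then have "connected_on (S - {y}) R" using extend[of y s] y by blast
    then show ?thesis using x y dd[of y] by metis
  next
    case False
    then have Ux: "R x u" if "u \<in> ?U" for u using that by blast
    have "\<exists>u\<in>?U. \<exists>w\<in>?U. u \<noteq> w \<and> \<not> R u w"
    proof (rule ccontr)
      assume "\<not> ?thesis"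
      then have "\<forall>u\<in>S - {x}. connected_on (S - {x} - {u}) R"
          "\<forall>u\<in>S - {x}. \<forall>w\<in>S - {x}. u \<noteq> w \<longrightarrow> R u w"
        using non_cut_vertices_adjacent_imp_clique[OF fin' x(2) sym] by blast+
      then show False using non_clique Ux sym by blast
    qed
    then obtain u w where uw: "u \<in> ?U" "w \<in> ?U" "u \<noteq> w" "\<not> R u w" by blast
    have "connected_on (S - {u}) R" "connected_on (S - {w}) R"
      using extend[of u w] extend[of w u] uw Ux by blast+
    moreover have "R u x" "R x w" using Ux uw sym by blast+
    ultimately show ?thesis using uw x by blast
  qed
qed

section \<open>Counting modulo two\<close>

lemma even_card_complement_range:
  "even (card {k. k < n \<and> \<not> Q k}) \<longleftrightarrow> (even (card {k. k < n \<and> Q k}) \<longleftrightarrow> even (n::nat))"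
proof -
  have "{..<n} = {k. k < n \<and> Q k} \<union> {k. k < n \<and> \<not> Q k}" by auto
  then have "n = card ({k. k < n \<and> Q k} \<union> {k. k < n \<and> \<not> Q k})" by (metis card_lessThan)
  also have "\<dots> = card {k. k < n \<and> Q k} + card {k. k < n \<and> \<not> Q k}"
    by (intro card_Un_disjoint) auto
  finally have "even n \<longleftrightarrow> even (card {k. k < n \<and> Q k} + card {k. k < n \<and> \<not> Q k})" by simp
  then show ?thesis by auto
qed

text \<open>\<open>T\<close> marks positions and \<open>F k\<close> marks the edge from
  \<open>k\<close> to \<open>k + 1\<close>. Between consecutive marked positions the number of
  marked edges has the parity of the distance: either one marked edge, or an even distance with
  none. These parities add up. \<open>T\<close> will be completeness to a set, or having a neighbour
  in \<open>X\<close>.\<close>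

lemma even_card_by_gaps:
  fixes T F :: "nat \<Rightarrow> bool"
  assumes "a \<le> b" "T a" "T b"
    and gap: "\<And>i j. a \<le> i \<Longrightarrow> i < j \<Longrightarrow> j \<le> b \<Longrightarrow> T i \<Longrightarrow> T j \<Longrightarrow> (\<And>k. i < k \<Longrightarrow> k < j \<Longrightarrow> \<not> T k)
      \<Longrightarrow> (j = i + 1 \<and> F i) \<or> (even (j - i) \<and> (\<forall>k. i \<le> k \<and> k < j \<longrightarrow> \<not> F k))"
  shows "even (card {k. a \<le> k \<and> k < b \<and> F k}) \<longleftrightarrow> even (b - a)"
  using assms
proof (induction b rule: less_induct)
  case (less b)
  show ?case
  proof (cases "a = b")
    case True
    then have "{k. a \<le> k \<and> k < b \<and> F k} = {}" by auto
    then show ?thesis using True by (simp only: card.empty) simp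
  next
    case False
    \<comment> \<open>The last marked position before \<open>b\<close>; the gap from
      \<open>i\<close> to \<open>b\<close> is split off.\<close>
    define i where "i = (GREATEST i. i < b \<and> a \<le> i \<and> T i)"
    have "a < b \<and> a \<le> a \<and> T a" using False less.prems by simp
    then have i: "i < b" "a \<le> i" "T i"
      using GreatestI_nat[of "\<lambda>i. i < b \<and> a \<le> i \<and> T i" a b] unfolding i_def by auto
    have "\<not> T k" if "i < k" "k < b" for k
      using that Greatest_le_nat[of "\<lambda>i. i < b \<and> a \<le> i \<and> T i" k b] i(2)
      unfolding i_def[symmetric] by auto
    then have g: "(b = i + 1 \<and> F i) \<or> (even (b - i) \<and> (\<forall>k. i \<le> k \<and> k < b \<longrightarrow> \<not> F k))"
      using less.prems(4)[of i b] less.prems(3) i by blast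
    have IH: "even (card {k. a \<le> k \<and> k < i \<and> F k}) \<longleftrightarrow> even (i - a)"
    proof (rule less.IH[OF i(1) i(2) less.prems(2) i(3)])
      fix k l assume "a \<le> k" "k < l" "l \<le> i" "T k" "T l" "\<And>m. k < m \<Longrightarrow> m < l \<Longrightarrow> \<not> T m"
      then show "(l = k + 1 \<and> F k) \<or> (even (l - k) \<and> (\<forall>m. k \<le> m \<and> m < l \<longrightarrow> \<not> F m))"
        using less.prems(4)[of k l] i(1) by simp
    qed
    from g show ?thesis
    proof
      assume "b = i + 1 \<and> F i"
      then have "{k. a \<le> k \<and> k < b \<and> F k} = insert i {k. a \<le> k \<and> k < i \<and> F k}"
        using i by auto
      then have "card {k. a \<le> k \<and> k < b \<and> F k} = Suc (card {k. a \<le> k \<and> k < i \<and> F k})"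
        by (simp add: card_insert_if)
      moreover have "b - a = Suc (i - a)" using \<open>b = i + 1 \<and> F i\<close> i by simp
      ultimately show ?thesis using IH by simp
    next
      assume A: "even (b - i) \<and> (\<forall>k. i \<le> k \<and> k < b \<longrightarrow> \<not> F k)"
      then have eq: "{k. a \<le> k \<and> k < b \<and> F k} = {k. a \<le> k \<and> k < i \<and> F k}"
        using i(1) by (auto simp: not_le[symmetric])
      have "b - a = (b - i) + (i - a)" using i by simp
      then have "even (b - a) \<longleftrightarrow> even (i - a)" using A by simp
      then show ?thesis using IH eq by simp
    qed
  qed
qed

text \<open>Double counting: index \<open>i\<close> is counted once for each subset of
  \<open>N i\<close>.\<close>

lemma sum_card_subset_edges:
  fixes N :: "nat \<Rightarrow> 'b set"
  assumes fin: "finite X" and sub: "\<And>i. i < n \<Longrightarrow> N i \<subseteq> X"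
  shows "(\<Sum>S\<in>Pow X. card {i. i < n \<and> S \<subseteq> N i}) = (\<Sum>i<n. 2 ^ card (N i))"
proof -
  have "(\<Sum>S\<in>Pow X. card {i. i < n \<and> S \<subseteq> N i}) = (\<Sum>S\<in>Pow X. \<Sum>i<n. if S \<subseteq> N i then 1 else 0)"
  proof (rule sum.cong[OF refl])
    fix S
    have "{i. i < n \<and> S \<subseteq> N i} = {..<n} \<inter> {i. S \<subseteq> N i}" by auto
    then show "card {i. i < n \<and> S \<subseteq> N i} = (\<Sum>i<n. if S \<subseteq> N i then 1 else 0)"
      by (simp add: sum.If_cases)
  qed
  also have "\<dots> = (\<Sum>i<n. \<Sum>S\<in>Pow X. if S \<subseteq> N i then 1 else 0)" by (rule sum.swap)
  also have "\<dots> = (\<Sum>i<n. 2 ^ card (N i))"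
  proof (rule sum.cong[OF refl])
    fix i assume "i \<in> {..<n}"
    then have "N i \<subseteq> X" using sub by simp
    then have "Pow X \<inter> {S. S \<subseteq> N i} = Pow (N i)" by blast
    then show "(\<Sum>S\<in>Pow X. if S \<subseteq> N i then 1 else 0) = (2::nat) ^ card (N i)"
      using fin \<open>N i \<subseteq> X\<close> by (simp add: sum.If_cases card_Pow finite_subset)
  qed
  finally show ?thesis .
qed

text \<open>Inclusion-exclusion modulo two. Summed over all \<open>S\<close>, the counts are odd
  exactly for the \<open>2 ^ card X - 1\<close> proper subsets, so the total is odd. Counted by
  indices the total is the sum of \<open>2 ^ card (N i)\<close>, where only the empty
  \<open>N i\<close> give odd terms.\<close>

lemma odd_count_proper_subsets_imp_odd_empty:
  fixes N :: "nat \<Rightarrow> 'b set"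
  assumes fin: "finite X" and ne: "X \<noteq> {}" and sub: "\<And>i. i < n \<Longrightarrow> N i \<subseteq> X"
    and odd: "\<And>S. S \<subset> X \<Longrightarrow> odd (card {i. i < n \<and> S \<subseteq> N i})"
    and full: "\<And>i. i < n \<Longrightarrow> N i \<noteq> X"
  shows "odd (card {i. i < n \<and> N i = {}})"
proof -
  have "{i. i < n \<and> X \<subseteq> N i} = {}" using sub full by blast
  then have "even (card {i. i < n \<and> X \<subseteq> N i})" by (simp only: card.empty) simp
  then have *: "odd (card {i. i < n \<and> S \<subseteq> N i}) \<longleftrightarrow> S \<in> Pow X - {X}" if "S \<in> Pow X" for S
    using that odd[of S] by (cases "S = X") auto
  have "{S \<in> Pow X. odd (card {i. i < n \<and> S \<subseteq> N i})} = Pow X - {X}"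
    using * by blast
  moreover have "card (Pow X - {X}) = 2 ^ card X - 1"
    using fin by (simp add: card_Pow)
  moreover have "odd ((2::nat) ^ card X - 1)"
    using fin ne by (simp add: card_gt_0_iff)
  ultimately have "odd (\<Sum>S\<in>Pow X. card {i. i < n \<and> S \<subseteq> N i})"
    using fin by (simp add: even_sum_iff)
  then have "odd (\<Sum>i<n. 2 ^ card (N i) :: nat)" using sum_card_subset_edges[OF fin sub] by simp
  moreover have "card (N i) = 0 \<longleftrightarrow> N i = {}" if "i < n" for i
    using finite_subset[OF sub[OF that] fin] by simp
  then have "{i \<in> {..<n}. odd ((2::nat) ^ card (N i))} = {i. i < n \<and> N i = {}}"
    by auto
  ultimately show ?thesis by (simp add: even_sum_iff)
qed

section \<open>Paths anchored at complete vertices\<close>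

locale berge_graph =
  fixes V :: "'a set" and E :: "'a \<Rightarrow> 'a \<Rightarrow> bool"
  assumes graph: "graph V E" and berge: "berge V E"
begin

text \<open>The same function as inside \<open>is_antihole\<close> and \<open>anticonnected\<close>,
  so these become statements about holes and connectivity for \<open>H\<close> by folding
  \<open>H_def\<close>.\<close>

definition H :: "'a \<Rightarrow> 'a \<Rightarrow> bool" where
  "H = (\<lambda>x y. x \<noteq> y \<and> \<not> E x y)"

lemma H_iff [simp]: "H x y \<longleftrightarrow> x \<noteq> y \<and> \<not> E x y"
  by (simp add: H_def)

lemma E_sym: "E x y \<Longrightarrow> E y x" and E_irrefl: "\<not> E x x"
  using graph unfolding graph_def by blast+

lemma E_commute: "E x y \<longleftrightarrow> E y x" using E_sym by blast

lemma H_sym: "H x y \<Longrightarrow> H y x" and H_irrefl: "\<not> H x x" using E_sym by auto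

text \<open>The vertex \<open>z\<close> closes \<open>q\<close> to a hole with one more vertex. Here
  \<open>length\<close> counts vertices, so the conclusion means an even number of edges.\<close>

lemma odd_path_if_closed:
  assumes "is_path V E q" "3 \<le> length q" "z \<in> V" "z \<notin> set q"
    and "\<And>u. u \<in> set q \<Longrightarrow> E z u \<longleftrightarrow> u = hd q \<or> u = last q"
  shows "odd (length q)"
proof -
  have "is_hole V E (z # q)" using is_hole_Cons[OF assms(1) E_sym E_irrefl assms(2-5)] by simp
  then have "even (length (z # q))" using berge unfolding berge_def by blast
  then show ?thesis by simp
qed

lemma odd_antipath_if_closed:
  assumes "is_path V H q" "3 \<le> length q" "z \<in> V" "z \<notin> set q"
    and "\<And>u. u \<in> set q \<Longrightarrow> H z u \<longleftrightarrow> u = hd q \<or> u = last q"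
  shows "odd (length q)"
proof -
  have "is_hole V H (z # q)"
    by (rule is_hole_Cons[OF assms(1) H_sym H_irrefl assms(2-5)])
  then have "even (length (z # q))" using berge unfolding berge_def is_antihole_def H_def by blast
  then show ?thesis by simp
qed

text \<open>The vertex \<open>v\<close> plays the part of the third complete vertex. It may be
  adjacent to the ends of \<open>p\<close>, but not to its interior.\<close>

definition anchored :: "'a set \<Rightarrow> 'a list \<Rightarrow> 'a \<Rightarrow> bool" where
  "anchored S p v \<longleftrightarrow> is_path (V - S) E p \<and> complete E S (hd p) \<and> complete E S (last p)
    \<and> v \<in> V \<and> v \<notin> set p \<and> complete E S v
    \<and> (\<forall>i. 0 < i \<longrightarrow> i + 1 < length p \<longrightarrow> \<not> E v (p!i))"

lemma anchoredD:
  assumes "anchored S p v"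
  shows "is_path (V - S) E p" "complete E S (hd p)" "complete E S (last p)"
    "v \<in> V" "v \<notin> set p" "complete E S v"
    "\<And>i. 0 < i \<Longrightarrow> i + 1 < length p \<Longrightarrow> \<not> E v (p!i)"
  using assms unfolding anchored_def by simp_all

lemma anchored_slice:
  assumes a: "anchored S p v" and ij: "i \<le> j" "j < length p"
    and c: "complete E S (p!i)" "complete E S (p!j)"
  shows "anchored S (slice p i j) v"
  unfolding anchored_def
proof (intro conjI allI impI)
  note A = anchoredD[OF a]
  show "is_path (V - S) E (slice p i j)" using is_path_slice[OF A(1) ij] .
  show "complete E S (hd (slice p i j))" "complete E S (last (slice p i j))"
    using c ij by (simp_all add: hd_slice last_slice)
  show "v \<in> V" "complete E S v" using A(4,6) by simp_all
  have "set (slice p i j) \<subseteq> set p" using ij by (auto simp: set_slice)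
  then show "v \<notin> set (slice p i j)" using A(5) by blast
  fix k assume k: "0 < k" "k + 1 < length (slice p i j)"
  then have "0 < i + k" "i + k + 1 < length p" using ij by (simp_all add: length_slice)
  then have "\<not> E v (p ! (i + k))" by (rule A(7))
  then show "\<not> E v (slice p i j ! k)" using k ij by (simp add: length_slice nth_slice)
qed

lemma anchored_subset:
  assumes a: "anchored X p v" and sub: "S \<subseteq> X"
  shows "anchored S p v"
proof -
  note A = anchoredD[OF a]
  have "is_path (V - S) E p" using is_path_mono[OF A(1)] is_pathD(3)[OF A(1)] sub by blast
  moreover have "complete E S u" if "complete E X u" for u
    using that sub unfolding complete_def by blast
  ultimately show ?thesis unfolding anchored_def using A by simp
qed

text \<open>The assumption \<open>gap\<close> is the form in which the induction hypothesis for
  \<open>S\<close> arrives. Cutting \<open>p\<close> at its \<open>S\<close>-complete vertices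
  yields single edges, which are counted, and anchored paths with incomplete interior, which have
  even length and no counted edge.\<close>

lemma complete_edges_parity_by_gaps:
  assumes gap: "\<And>q. anchored S q v \<Longrightarrow> 3 \<le> length q \<Longrightarrow>
      (\<And>i. 0 < i \<Longrightarrow> i + 1 < length q \<Longrightarrow> \<not> complete E S (q!i)) \<Longrightarrow> odd (length q)"
    and a: "anchored S p v"
  shows "even (path_complete_edges E S p) \<longleftrightarrow> odd (length p)"
proof -
  let ?T = "\<lambda>k. complete E S (p!k)"
  let ?n = "length p - 1"
  have ne: "p \<noteq> []" using is_pathD(1)[OF anchoredD(1)[OF a]] .
  have "even (card {k. 0 \<le> k \<and> k < ?n \<and> ?T k \<and> ?T (k + 1)}) \<longleftrightarrow> even (?n - 0)"
  proof (rule even_card_by_gaps[where T = ?T])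
    show "?T 0" "?T ?n" using anchoredD(2,3)[OF a] ne by (simp_all add: hd_conv_nth last_conv_nth)
    fix i j assume ij: "i < j" "j \<le> ?n" "?T i" "?T j" and no: "\<And>k. i < k \<Longrightarrow> k < j \<Longrightarrow> \<not> ?T k"
    show "j = i + 1 \<and> ?T i \<and> ?T (i + 1)
        \<or> even (j - i) \<and> (\<forall>k. i \<le> k \<and> k < j \<longrightarrow> \<not> (?T k \<and> ?T (k + 1)))"
    proof (cases "j = i + 1")
      case True then show ?thesis using ij by simp
    next
      case False
      have j: "i \<le> j" "j < length p" using ij by linarith+
      have len: "length (slice p i j) = Suc j - i" using length_slice[OF j] .
      have "odd (length (slice p i j))"
      proof (rule gap[OF anchored_slice[OF a j ij(3,4)]])
        show "3 \<le> length (slice p i j)" using len ij(1) False by linarith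
        fix k assume "0 < k" "k + 1 < length (slice p i j)"
        then show "\<not> complete E S (slice p i j ! k)"
          using no[of "i + k"] j by (simp add: len nth_slice)
      qed
      moreover have "\<not> (?T k \<and> ?T (k + 1))" if "i \<le> k" "k < j" for k
        using no[of k] no[of "k + 1"] that False by (cases "k = i") auto
      ultimately show ?thesis using len ij(1) by auto
    qed
  qed simp
  moreover have "{k. 0 \<le> k \<and> k < ?n \<and> ?T k \<and> ?T (k + 1)}
      = {i. i + 1 < length p \<and> ?T i \<and> ?T (i + 1)}" by auto
  ultimately have "even (path_complete_edges E S p) \<longleftrightarrow> even ?n"
    unfolding path_complete_edges_def by simp
  then show ?thesis using ne by (cases p) auto
qed

section \<open>Excluding anchored paths with an odd number of edges\<close>

text \<open>Each inner vertex misses some vertex of \<open>X\<close>, so an antipath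
  \<open>q\<close> joins \<open>p!1\<close> to \<open>p!2\<close> through \<open>X\<close>. It
  closes to an antihole through \<open>v\<close>, and also through the two ends of \<open>p\<close>;
  these antiholes have \<open>length q + 1\<close> and \<open>length q + 2\<close> vertices, so one
  of them is odd.\<close>

lemma no_anchored_path_of_length_three:
  assumes a: "anchored X p v" and X: "X \<subseteq> V" "anticonnected E X"
    and len: "length p = 4" and c: "\<not> complete E X (p!1)" "\<not> complete E X (p!2)"
  shows False
proof -
  note A = anchoredD[OF a]
  note P = is_pathD[OF A(1)]
  have adj: "E (p!i) (p!j) \<longleftrightarrow> i + 1 = j \<or> j + 1 = i" if "i < 4" "j < 4" for i j
    using P(4)[of i j] that len by simp
  have pV: "p!i \<in> V" "p!i \<notin> X" if "i < 4" for i
    using that subsetD[OF P(3) nth_mem[of i]] len by auto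
  have neq: "p!i \<noteq> p!j" if "i < 4" "j < 4" "i \<noteq> j" for i j
    using that P(2) len by (simp add: nth_eq_iff_index_eq)
  have ends: "complete E X (p!0)" "complete E X (p!3)"
    using A(2,3) P(1) len by (simp_all add: hd_conv_nth last_conv_nth)
  let ?S = "insert (p!2) (insert (p!1) X)"
  obtain x where x: "x \<in> X" "\<not> E (p!1) x" using c(1) unfolding complete_def by blast
  obtain y where y: "y \<in> X" "\<not> E (p!2) y" using c(2) unfolding complete_def by blast
  have "H x (p!1)" "H y (p!2)" using x y pV[of 1] pV[of 2] E_commute by auto
  have conn1: "connected_on (insert (p!1) X) H"
    by (rule connected_on_insert[OF X(2)[unfolded anticonnected_def, folded H_def] H_sym x(1) \<open>H x (p!1)\<close>])
  have conn: "connected_on ?S H"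
    by (rule connected_on_insert[OF conn1 H_sym insertI2[OF y(1)] \<open>H y (p!2)\<close>])
  obtain q where q: "is_path ?S H q" "hd q = p!1" "last q = p!2"
    using induced_path_exists[OF H_sym H_irrefl conn, of "p!1" "p!2"] by blast
  note Q = is_pathD[OF q(1)]
  have q0: "q!0 = p!1" "q!(length q - 1) = p!2" using q(2,3) Q(1) by (simp_all add: hd_conv_nth last_conv_nth)
  have lenq: "3 \<le> length q"
  proof (rule ccontr)
    assume "\<not> ?thesis"
    moreover have "length q \<noteq> 0" using Q(1) by simp
    ultimately have "length q = 1 \<or> length q = 2" by linarith
    then show False
    proof
      assume "length q = 1" then show False using q0 neq[of 1 2] by simp
    next
      assume l: "length q = 2"
      then have "H (p!1) (p!2)" using Q(4)[of 0 1] q0 by simp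
      then show False using adj[of 1 2] by simp
    qed
  qed
  have qV: "set q \<subseteq> V" using Q(3) X(1) pV[of 1] pV[of 2] by auto
  have qP: "is_path V H q" using is_path_mono[OF q(1) qV] .
  have qX: "u \<in> X" if "u \<in> set q" "u \<noteq> p!1" "u \<noteq> p!2" for u using that Q(3) by blast
  have in_p: "p!i \<in> set p" if "i < 4" for i using that len by simp
  have "odd (length q)"
  proof (rule odd_antipath_if_closed[OF qP lenq A(4)])
    show "v \<notin> set q"
      using qX[of v] A(5,6) in_p[of 1] in_p[of 2] E_irrefl[of v] unfolding complete_def by auto
    have "\<not> E v (p!1)" "\<not> E v (p!2)" using A(7)[of 1] A(7)[of 2] len by simp_all
    then show "H v u \<longleftrightarrow> u = hd q \<or> u = last q" if "u \<in> set q" for u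
      using qX[OF that] A(5,6) in_p[of 1] in_p[of 2] q(2,3) unfolding complete_def by auto
  qed
  \<comment> \<open>antihole \<open>q, p!0, p!3\<close>; the previous one was \<open>q, v\<close>\<close>
  moreover have "odd (length (q @ [p!0]))"
  proof (rule odd_antipath_if_closed)
    have nin: "p!i \<notin> set q" if "i = 0 \<or> i = 3" for i
      using that qX[of "p!i"] pV[of i] neq[of i 1] neq[of i 2] by auto
    have H0: "H (p!0) u \<longleftrightarrow> u = p!2" if "u \<in> set q" for u
    proof (cases "u = p!1 \<or> u = p!2")
      case True then show ?thesis using adj[of 0 1] adj[of 0 2] neq[of 0 1] neq[of 0 2] neq[of 1 2] by auto
    next
      case False
      then show ?thesis using qX[OF that] ends(1) unfolding complete_def by auto
    qed
    have H3: "H (p!3) u \<longleftrightarrow> u = p!1" if "u \<in> set q" for u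
    proof (cases "u = p!1 \<or> u = p!2")
      case True then show ?thesis using adj[of 3 1] adj[of 3 2] neq[of 3 1] neq[of 3 2] neq[of 1 2] by auto
    next
      case False
      then show ?thesis using qX[OF that] ends(2) unfolding complete_def by auto
    qed
    show "is_path V H (q @ [p!0])"
      by (rule is_path_snoc[OF qP H_sym H_irrefl]) (use pV[of 0] nin[of 0] H0 q(3) in auto)
    show "3 \<le> length (q @ [p!0])" using lenq by simp
    show "p!3 \<in> V" using pV by simp
    show "p!3 \<notin> set (q @ [p!0])" using nin[of 3] neq[of 3 0] by simp
    have hq: "hd (q @ [p!0]) = p!1" using q(2) Q(1) by simp
    have H30: "H (p!3) (p!0)" using adj[of 3 0] neq[of 3 0] by simp
    show "H (p!3) u \<longleftrightarrow> u = hd (q @ [p!0]) \<or> u = last (q @ [p!0])" if u: "u \<in> set (q @ [p!0])" for u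
    proof (cases "u = p!0")
      case True then show ?thesis using H30 by simp
    next
      case False then show ?thesis using u H3[of u] hq by simp
    qed
  qed
  ultimately show False by simp
qed

text \<open>The gap between consecutive neighbours of \<open>X\<close> closes to a hole through a common neighbour, or
  through \<open>x\<close>, \<open>v\<close> and \<open>y\<close>.\<close>
lemma stable_gap:
  assumes a: "anchored X p v" and X: "X \<subseteq> V" and stable: "\<And>x y. x \<in> X \<Longrightarrow> y \<in> X \<Longrightarrow> \<not> E x y"
    and ij: "i < j" "j < length p" and x: "x \<in> X" "E (p!i) x" and y: "y \<in> X" "E (p!j) y"
    and no: "\<And>k z. i < k \<Longrightarrow> k < j \<Longrightarrow> z \<in> X \<Longrightarrow> \<not> E (p!k) z"
  shows "(j = i + 1 \<and> (\<exists>z\<in>X. E (p!i) z \<and> E (p!j) z)) \<or> even (j - i)"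
proof -
  note A = anchoredD[OF a]
  note P = is_pathD[OF A(1)]
  let ?q = "slice p i j"
  have ij': "i \<le> j" using ij by simp
  have q: "is_path (V - X) E ?q" "length ?q = Suc j - i" "hd ?q = p!i" "last ?q = p!j"
    using is_path_slice[OF A(1) ij' ij(2)] length_slice hd_slice last_slice ij' ij(2) by auto
  have qV: "set ?q \<subseteq> V - X" using is_pathD(3)[OF q(1)] .
  then have qP: "is_path V E ?q" using is_path_mono[OF q(1)] by blast
  have elem: "\<exists>k. i \<le> k \<and> k \<le> j \<and> u = p!k" if "u \<in> set ?q" for u
    using that set_slice[OF ij' ij(2)] by auto
  have mid: "\<not> E z u" if u: "u \<in> set ?q" "u \<noteq> p!i" "u \<noteq> p!j" "z \<in> X" for u z
  proof -
    obtain k where k: "i \<le> k" "k \<le> j" "u = p!k" using elem[OF u(1)] by blast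
    then have "i < k" "k < j" using u(2,3) by (auto simp: le_less)
    then show ?thesis using no[OF _ _ u(4)] k(3) E_sym by blast
  qed
  have nin: "z \<notin> set ?q" if "z \<in> X" for z using that qV by blast
  show ?thesis
  proof (cases "\<exists>z\<in>X. E (p!i) z \<and> E (p!j) z")
    case True
    then obtain z where z: "z \<in> X" "E (p!i) z" "E (p!j) z" by blast
    show ?thesis
    proof (cases "j = i + 1")
      case False
      have "odd (length ?q)"
      proof (rule odd_path_if_closed[OF qP])
        show "3 \<le> length ?q" using q(2) ij False by linarith
        show "z \<in> V" "z \<notin> set ?q" using z(1) X nin by auto
        show "E z u \<longleftrightarrow> u = hd ?q \<or> u = last ?q" if "u \<in> set ?q" for u
          using mid[OF that _ _ z(1)] z E_sym unfolding q(3,4) by blast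
      qed
      then show ?thesis using q(2) ij by auto
    qed (use True in simp)
  next
    case False
    \<comment> \<open>Without a common neighbour neither \<open>i\<close> nor \<open>j\<close> is an
      end of \<open>p\<close>, because the ends are adjacent to all of \<open>X\<close>. Hence
      \<open>v\<close> has no neighbour on the whole slice.\<close>
    then have no_x: "\<not> E (p!j) x" and no_y: "\<not> E (p!i) y" using x y by blast+
    have ends: "complete E X (p!0)" "complete E X (p!(length p - 1))"
      using A(2,3) P(1) by (simp_all add: hd_conv_nth last_conv_nth)
    have i0: "0 < i" using no_y y(1) ends(1) unfolding complete_def by (cases i) auto
    have "j \<noteq> length p - 1" using no_x x(1) ends(2) unfolding complete_def by metis
    then have jn: "j + 1 < length p" using ij by linarith
    have inner: "\<not> E v u" if u: "u \<in> set ?q" for u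
    proof -
      obtain k where k: "i \<le> k" "k \<le> j" "u = p!k" using elem[OF u] by blast
      then show ?thesis using A(7)[of k] i0 jn by simp
    qed
    have xy: "x \<noteq> y" "p!i \<noteq> p!j" using no_x y x no_y by auto
    have "odd (length ((x # ?q) @ [y]))"
    proof (rule odd_path_if_closed)
      have 1: "is_path V E (x # ?q)"
      proof (rule is_path_Cons[OF qP E_sym E_irrefl])
        show "x \<in> V" "x \<notin> set ?q" using x X nin by auto
        show "E x u \<longleftrightarrow> u = hd ?q" if "u \<in> set ?q" for u
          using mid[OF that _ _ x(1)] x(2) no_x E_sym xy unfolding q(3) by blast
      qed
      have q_ne: "?q \<noteq> []" using q(2) ij by auto
      show "is_path V E ((x # ?q) @ [y])"
      proof (rule is_path_snoc[OF 1 E_sym E_irrefl])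
        show "y \<in> V" "y \<notin> set (x # ?q)" using y X nin xy by auto
        have la: "last (x # ?q) = p!j" using q(4) q_ne by simp
        show "E y u \<longleftrightarrow> u = last (x # ?q)" if "u \<in> set (x # ?q)" for u
        proof (cases "u = x")
          case True
          have "x \<noteq> p!j" using nin[OF x(1)] q(4) q_ne last_in_set by metis
          then show ?thesis using True la stable[OF y(1) x(1)] by simp
        next
          case False
          then have "u \<in> set ?q" using that by simp
          then show ?thesis using mid[of u y] y no_y E_sym xy unfolding la by blast
        qed
      qed
      show "3 \<le> length ((x # ?q) @ [y])" using q(2) ij by simp
      show "v \<in> V" using A(4) .
      have vX: "E v z" if "z \<in> X" for z using A(6) that unfolding complete_def by blast
      have "set ?q \<subseteq> set p" using set_slice[OF ij' ij(2)] ij by auto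
      moreover have "v \<noteq> x" "v \<noteq> y" using vX[OF x(1)] vX[OF y(1)] E_irrefl by metis+
      ultimately show "v \<notin> set ((x # ?q) @ [y])" using A(5) by auto
      show "E v u \<longleftrightarrow> u = hd ((x # ?q) @ [y]) \<or> u = last ((x # ?q) @ [y])"
        if "u \<in> set ((x # ?q) @ [y])" for u
        using that inner[of u] vX[OF x(1)] vX[OF y(1)] by auto
    qed
    then show ?thesis using q(2) ij by auto
  qed
qed

text \<open>\<open>N i\<close> collects the vertices of \<open>X\<close> adjacent to both ends of
  edge \<open>i\<close>, so the edge is \<open>S\<close>-complete iff \<open>S\<close> lies in
  \<open>N i\<close>. By inclusion-exclusion an odd number of the \<open>n\<close> edges have
  \<open>N i\<close> empty, hence an even number have it nonempty. The gaps between positions with a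
  neighbour in \<open>X\<close> show that the latter number has the parity of \<open>n\<close>,
  which is odd.\<close>

lemma no_anchored_path_stable:
  assumes a: "anchored X p v" and X: "X \<subseteq> V" "X \<noteq> {}"
    and stable: "\<And>x y. x \<in> X \<Longrightarrow> y \<in> X \<Longrightarrow> \<not> E x y"
    and len: "even (length p)" "4 \<le> length p"
    and inner: "\<And>i. 0 < i \<Longrightarrow> i + 1 < length p \<Longrightarrow> \<not> complete E X (p!i)"
    and IH: "\<And>S. S \<subset> X \<Longrightarrow> S \<noteq> {} \<Longrightarrow> odd (path_complete_edges E S p)"
  shows False
proof -
  note A = anchoredD[OF a]
  note P = is_pathD[OF A(1)]
  define n where "n = length p - 1"
  define N where "N i = {x \<in> X. E (p!i) x \<and> E (p!(i+1)) x}" for i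
  have n: "odd n" "3 \<le> n" "length p = n + 1" using len unfolding n_def by auto
  have fin: "finite X" using X(1) graph finite_subset unfolding graph_def by blast
  have "odd (card {i. i < n \<and> N i = {}})"
  proof (rule odd_count_proper_subsets_imp_odd_empty[OF fin X(2)])
    show "N i \<subseteq> X" for i unfolding N_def by blast
    \<comment> \<open>As \<open>p\<close> has at least three edges, every edge has an interior end,
      and that end is not \<open>X\<close>-complete.\<close>
    show "N i \<noteq> X" if "i < n" for i
    proof
      assume "N i = X"
      then have "complete E X (p!i)" "complete E X (p!(i+1))" unfolding N_def complete_def by blast+
      then show False using inner[of i] inner[of "i + 1"] that n by (cases "i = 0") auto
    qed
    show "odd (card {i. i < n \<and> S \<subseteq> N i})" if S: "S \<subset> X" for S
    proof (cases "S = {}")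
      case True
      \<comment> \<open>For empty \<open>S\<close> the induction hypothesis says nothing, but every
        edge counts and \<open>n\<close> is odd.\<close>
      have "{i. i < n \<and> S \<subseteq> N i} = {..<n}" using True by auto
      then show ?thesis using n(1) by simp
    next
      case False
      have "S \<subseteq> N i \<longleftrightarrow> complete E S (p!i) \<and> complete E S (p!(i+1))" for i
        using S unfolding N_def complete_def by blast
      then have "{i. i < n \<and> S \<subseteq> N i}
          = {i. i + 1 < length p \<and> complete E S (p!i) \<and> complete E S (p!(i+1))}"
        using n(3) by auto
      then show ?thesis using IH[OF S False] unfolding path_complete_edges_def by simp
    qed
  qed
  then have ev: "even (card {i. i < n \<and> N i \<noteq> {}})"
    using even_card_complement_range[of n "\<lambda>i. N i = {}"] n(1) by simp
  let ?T = "\<lambda>k. \<exists>x\<in>X. E (p!k) x"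
  have "even (card {k. 0 \<le> k \<and> k < n \<and> N k \<noteq> {}}) \<longleftrightarrow> even (n - 0)"
  proof (rule even_card_by_gaps[where T = ?T])
    have "complete E X (p!0)" "complete E X (p!n)"
      using A(2,3) P(1) unfolding n_def by (simp_all add: hd_conv_nth last_conv_nth)
    then show "?T 0" "?T n" using X(2) unfolding complete_def by blast+
    fix i j assume ij: "i < j" "j \<le> n" and T: "?T i" "?T j"
      and no: "\<And>k. i < k \<Longrightarrow> k < j \<Longrightarrow> \<not> ?T k"
    have gap: "(j = i + 1 \<and> (\<exists>z\<in>X. E (p!i) z \<and> E (p!j) z)) \<or> even (j - i)"
    proof -
      obtain x y where "x \<in> X" "E (p!i) x" "y \<in> X" "E (p!j) y" using T by blast
      then show ?thesis using stable_gap[OF a X(1) stable ij(1)] no ij(2) n(3) by auto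
    qed
    show "(j = i + 1 \<and> N i \<noteq> {}) \<or> (even (j - i) \<and> (\<forall>k. i \<le> k \<and> k < j \<longrightarrow> \<not> N k \<noteq> {}))"
    proof (cases "j = i + 1")
      case True
      then show ?thesis using gap unfolding N_def by auto
    next
      case False
      have "N k = {}" if "i \<le> k" "k < j" for k
      proof (rule ccontr)
        assume "N k \<noteq> {}"
        then have "?T k" "?T (k + 1)" unfolding N_def by blast+
        then show False using no[of k] no[of "k + 1"] that False by (cases "k = i") auto
      qed
      then show ?thesis using gap False by simp
    qed
  qed simp
  then show False using ev n(1) by simp
qed

text \<open>In the complement, an interior vertex complete to \<open>X - {x}\<close> attaches to
  \<open>R\<close> at \<open>x\<close> only, and one complete to \<open>X - {y}\<close> at
  \<open>y\<close> only. Two such vertices close \<open>R\<close> to an antihole, directly if they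
  are nonadjacent and through \<open>v\<close> if they are adjacent, which forces
  \<open>length R\<close> to be even or odd, respectively. Each parity of \<open>length R\<close>
  then contradicts the counts of complete edges. The first alternative in \<open>odd_xy\<close>
  serves when \<open>X - {x, y}\<close> may fail to be anticonnected.\<close>

lemma no_anchored_path_if_antipath:
  assumes a: "anchored X p v" and X: "X \<subseteq> V" and len: "even (length p)" "6 \<le> length p"
    and inner: "\<And>i. 0 < i \<Longrightarrow> i + 1 < length p \<Longrightarrow> \<not> complete E X (p!i)"
    and xy: "x \<in> X" "y \<in> X" "x \<noteq> y" "E x y"
    and R: "is_path X H R" "hd R = x" "last R = y"
    and odd_x: "odd (path_complete_edges E (X - {x}) p)"
    and odd_y: "odd (path_complete_edges E (X - {y}) p)"
    and odd_xy: "odd (length R) \<or> odd (path_complete_edges E (X - {x, y}) p)"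
  shows False
proof -
  note A = anchoredD[OF a]
  note P = is_pathD[OF A(1)]
  note RP = is_pathD[OF R(1)]
  define n where "n = length p - 1"
  have n: "odd n" "5 \<le> n" "length p = n + 1" using len unfolding n_def by auto
  have lenR: "3 \<le> length R"
  proof (rule ccontr)
    assume "\<not> ?thesis"
    moreover have "length R \<noteq> 0" using RP(1) by simp
    ultimately have "length R = 1 \<or> length R = 2" by linarith
    moreover have R0: "R!0 = x" "R!(length R - 1) = y"
      using R(2,3) RP(1) by (simp_all add: hd_conv_nth last_conv_nth)
    ultimately show False
    proof (elim disjE)
      assume "length R = 1" then show False using R0 xy by simp
    next
      assume l: "length R = 2"
      then have "H x y" using RP(4)[of 0 1] R0 by simp
      then show False using xy by simp
    qed
  qed
  have R_V: "is_path V H R" using is_path_mono[OF R(1)] RP(3) X by blast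
  have adj: "E (p!i) (p!j) \<longleftrightarrow> i + 1 = j \<or> j + 1 = i" if "i \<le> n" "j \<le> n" for i j
    using P(4)[of i j] that n(3) by simp
  have pV: "p!i \<in> V" "p!i \<notin> X" if "i \<le> n" for i
    using that subsetD[OF P(3) nth_mem[of i]] n(3) by auto
  have pR: "p!i \<notin> set R" if "i \<le> n" for i using pV[OF that] RP(3) by blast
  have neq: "p!i \<noteq> p!j" if "i \<le> n" "j \<le> n" "i \<noteq> j" for i j
    using that P(2) n(3) by (simp add: nth_eq_iff_index_eq)
  have v_R: "\<not> H v u" if "u \<in> set R" for u
    using that RP(3) A(6) unfolding complete_def by auto
  have v_nin: "v \<notin> set R"
    using RP(3) A(6) E_irrefl[of v] unfolding complete_def by blast
  have v_p: "v \<noteq> p!i" if "i \<le> n" for i using A(5) that n(3) nth_mem[of i p] by auto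
  have v_H: "H v (p!i)" if "0 < i" "i < n" for i
    using A(7)[of i] that n(3) v_p[of i] by simp
  define CX where "CX k \<longleftrightarrow> complete E (X - {x}) (p!k)" for k
  define CY where "CY k \<longleftrightarrow> complete E (X - {y}) (p!k)" for k
  define CZ where "CZ k \<longleftrightarrow> complete E (X - {x, y}) (p!k)" for k
  have "complete E X (p!0)" "complete E X (p!n)"
    using A(2,3) P(1) unfolding n_def by (simp_all add: hd_conv_nth last_conv_nth)
  then have ends: "CX 0" "CX n" "CY 0" "CY n"
    unfolding CX_def CY_def complete_def by blast+
  have disj: "\<not> (CX k \<and> CY k)" if "0 < k" "k < n" for k
    using inner[of k] that n(3) xy(3) unfolding CX_def CY_def complete_def by auto
  have CXH: "H (p!k) u \<longleftrightarrow> u = x" if "CX k" "0 < k" "k < n" "u \<in> set R" for k u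
  proof -
    have "\<not> E (p!k) x"
      using inner[of k] that(1-3) n(3) unfolding CX_def complete_def by auto
    moreover have "u \<in> X" "p!k \<noteq> u" using that RP(3) pV[of k] by auto
    ultimately show ?thesis using that(1) unfolding CX_def complete_def by auto
  qed
  have CYH: "H (p!k) u \<longleftrightarrow> u = y" if "CY k" "0 < k" "k < n" "u \<in> set R" for k u
  proof -
    have "\<not> E (p!k) y"
      using inner[of k] that(1-3) n(3) unfolding CY_def complete_def by auto
    moreover have "u \<in> X" "p!k \<noteq> u" using that RP(3) pV[of k] by auto
    ultimately show ?thesis using that(1) unfolding CY_def complete_def by auto
  qed
  have path_a: "is_path V H (p!k # R)" if "CX k" "0 < k" "k < n" for k
    by (rule is_path_Cons[OF R_V H_sym H_irrefl pV(1)[of k] pR[of k]])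
      (use that CXH[OF that] R(2) in auto)
  \<comment> \<open>antihole \<open>p!k, R, p!l\<close>\<close>
  have far: "even (length R)"
    if k: "CX k" "0 < k" "k < n" and l: "CY l" "0 < l" "l < n" and kl: "\<not> (k + 1 = l \<or> l + 1 = k)" for k l
  proof -
    have kneq: "k \<noteq> l" using disj[of k] k l by blast
    have "odd (length (p!k # R))"
    proof (rule odd_antipath_if_closed[OF path_a[OF k]])
      show "3 \<le> length (p!k # R)" using lenR by simp
      show "p!l \<in> V" using pV l by simp
      show "p!l \<notin> set (p!k # R)" using pR[of l] neq[of l k] k l kneq by auto
      have Hlk: "H (p!l) (p!k)" using adj[of l k] neq[of l k] k l kl kneq by simp
      have lk: "p!k \<notin> set R" "p!l \<notin> set R" using pR k l by auto
      have yR: "last (p!k # R) = y" using R(3) RP(1) by simp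
      show "H (p!l) u \<longleftrightarrow> u = hd (p!k # R) \<or> u = last (p!k # R)" if u: "u \<in> set (p!k # R)" for u
      proof (cases "u = p!k")
        case True then show ?thesis using Hlk by simp
      next
        case False
        then have "u \<in> set R" using u by simp
        from CYH[OF l this] show ?thesis using False yR by simp
      qed
    qed
    then show ?thesis by simp
  qed
  \<comment> \<open>antihole \<open>p!k, R, p!l, v\<close>\<close>
  have near: "odd (length R)"
    if k: "CX k" "0 < k" "k < n" and l: "CY l" "0 < l" "l < n" and kl: "k + 1 = l \<or> l + 1 = k" for k l
  proof -
    have yR: "last (p!k # R) = y" using R(3) RP(1) by simp
    have "odd (length ((p!k # R) @ [p!l]))"
    proof (rule odd_antipath_if_closed)
      show "is_path V H ((p!k # R) @ [p!l])"
      proof (rule is_path_snoc[OF path_a[OF k] H_sym H_irrefl])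
        show "p!l \<in> V" using pV l by simp
        show "p!l \<notin> set (p!k # R)" using pR[of l] neq[of l k] k l kl by auto
        show "H (p!l) u \<longleftrightarrow> u = last (p!k # R)" if u: "u \<in> set (p!k # R)" for u
        proof (cases "u = p!k")
          case True
          have "y \<in> set R" using R(3) RP(1) last_in_set by blast
          then have "p!k \<noteq> y" using pR[of k] k by auto
          moreover have "\<not> H (p!l) (p!k)" using adj[of l k] k l kl by auto
          ultimately show ?thesis using True yR by simp
        next
          case False
          then have "u \<in> set R" using u by simp
          from CYH[OF l this] show ?thesis using yR by simp
        qed
      qed
      show "3 \<le> length ((p!k # R) @ [p!l])" using lenR by simp
      show "v \<in> V" using A(4) .
      show "v \<notin> set ((p!k # R) @ [p!l])" using v_nin v_p[of k] v_p[of l] k l by auto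
      show "H v u \<longleftrightarrow> u = hd ((p!k # R) @ [p!l]) \<or> u = last ((p!k # R) @ [p!l])"
        if "u \<in> set ((p!k # R) @ [p!l])" for u
      proof (cases "u \<in> set R")
        case True
        then have "u \<noteq> p!k" "u \<noteq> p!l" using pR[of k] pR[of l] k l by auto
        then show ?thesis using v_R[OF True] by simp
      next
        case False
        then have "u = p!k \<or> u = p!l" using that by auto
        then show ?thesis using v_H[OF k(2,3)] v_H[OF l(2,3)] by auto
      qed
    qed
    then show ?thesis by simp
  qed
  let ?e = "\<lambda>C. {k. k < n \<and> C k \<and> C (k + 1)}"
  have e: "path_complete_edges E (X - {x}) p = card (?e CX)"
      "path_complete_edges E (X - {y}) p = card (?e CY)"
      "path_complete_edges E (X - {x, y}) p = card (?e CZ)"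
    unfolding path_complete_edges_def CX_def CY_def CZ_def n(3) by simp_all
  show False
  proof (cases "odd (length R)")
    case True
    obtain i where i: "i < n" "CX i" "CX (i + 1)"
      using odd_x unfolding e by (metis (mono_tags, lifting) card.empty empty_Collect_eq even_zero)
    obtain j where j: "j < n" "CY j" "CY (j + 1)"
      using odd_y unfolding e by (metis (mono_tags, lifting) card.empty empty_Collect_eq even_zero)
    have *: "k + 1 = l \<or> l + 1 = k" if "CX k" "0 < k" "k < n" "CY l" "0 < l" "l < n" for k l
      using far[OF that] True by blast
    \<comment> \<open>No position is consecutive to both ends of an edge, so neither edge can be
      interior. Each therefore lies at an end of \<open>p\<close>, and its interior end is
      \<open>1\<close> or \<open>n - 1\<close>; since \<open>n\<close> is at least 5, two such
      positions are never consecutive.\<close>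
    show False
      using *[of i j] *[of "i + 1" j] *[of i "j + 1"] *[of "i + 1" "j + 1"] i j n(2)
      by (cases "i = 0"; cases "j = 0"; cases "i + 1 = n"; cases "j + 1 = n") auto
  next
    case False
    \<comment> \<open>Otherwise \<open>p!k\<close> misses both \<open>x\<close> and \<open>y\<close>
      but no other vertex of \<open>R\<close>, and closes \<open>R\<close> to an antihole with an
      odd number of vertices.\<close>
    have CZ_inner: "CX k \<or> CY k" if "CZ k" "0 < k" "k < n" for k
    proof (rule ccontr)
      assume no: "\<not> ?thesis"
      have E: "E (p!k) u" if "u \<in> X" "u \<noteq> x" "u \<noteq> y" for u
        using \<open>CZ k\<close> that unfolding CZ_def complete_def by blast
      have Ex: "\<not> E (p!k) x"
      proof
        assume "E (p!k) x"
        then have "CY k" unfolding CY_def complete_def using E by blast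
        then show False using no by blast
      qed
      have Ey: "\<not> E (p!k) y"
      proof
        assume "E (p!k) y"
        then have "CX k" unfolding CX_def complete_def using E by blast
        then show False using no by blast
      qed
      have "odd (length R)"
      proof (rule odd_antipath_if_closed[OF R_V lenR])
        show "p!k \<in> V" "p!k \<notin> set R" using pV pR that by simp_all
        show "H (p!k) u \<longleftrightarrow> u = hd R \<or> u = last R" if u: "u \<in> set R" for u
        proof -
          have "u \<in> X" "u \<noteq> p!k" using u RP(3) pR[of k] \<open>k < n\<close> by auto
          then show ?thesis using E[of u] Ex Ey unfolding R(2,3) by auto
        qed
      qed
      then show False using False by blast
    qed
    have CZ_if: "CZ k" if "CX k \<or> CY k" for k
      using that unfolding CX_def CY_def CZ_def complete_def by blast
    have not_near: "\<not> (CX k \<and> CY l)" if "0 < k" "k < n" "0 < l" "l < n" "k + 1 = l \<or> l + 1 = k" for k l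
      using near[of k l] that False by blast
    \<comment> \<open>For even \<open>length R\<close> no interior \<open>CX\<close> position is
      next to an interior \<open>CY\<close> position, so both ends of a \<open>CZ\<close> edge are
      of the same kind. The union is disjoint, and two odd numbers add to an even one.\<close>
    have "?e CZ = ?e CX \<union> ?e CY"
    proof (intro equalityI subsetI)
      fix k assume "k \<in> ?e CZ"
      then have k: "k < n" "CZ k" "CZ (k + 1)" by auto
      show "k \<in> ?e CX \<union> ?e CY"
      proof (cases "k = 0")
        case True
        then show ?thesis using CZ_inner[of 1] k n(2) ends by auto
      next
        case k0: False
        show ?thesis
        proof (cases "k + 1 = n")
          case True
          then show ?thesis using CZ_inner[of k] k k0 ends by auto
        next
          case False
          then show ?thesis
            using CZ_inner[of k] CZ_inner[of "k + 1"] k k0 not_near[of k "k + 1"] not_near[of "k + 1" k]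
            by auto
        qed
      qed
    qed (use CZ_if in auto)
    moreover have "?e CX \<inter> ?e CY = {}"
    proof -
      have "\<not> (CX k \<and> CX (k + 1) \<and> CY k \<and> CY (k + 1))" if "k < n" for k
        using disj[of k] disj[of "k + 1"] that n(2) by (cases "k = 0") auto
      then show ?thesis by blast
    qed
    ultimately have "card (?e CZ) = card (?e CX) + card (?e CY)"
      by (simp add: card_Un_disjoint)
    then show False using odd_x odd_y odd_xy False unfolding e by simp
  qed
qed

text \<open>Under the contrary assumption that \<open>length p\<close> is even, the induction
  hypothesis turns into an odd number of \<open>S\<close>-complete edges for each nonempty
  anticonnected proper subset \<open>S\<close>. Four vertices are treated apart because the antipath
  argument needs \<open>6 \<le> length p\<close>.\<close>

lemma odd_length_if_inner_incomplete:
  assumes "X \<subseteq> V" "X \<noteq> {}" "anticonnected E X" "anchored X p v" "3 \<le> length p"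
    and "\<And>i. 0 < i \<Longrightarrow> i + 1 < length p \<Longrightarrow> \<not> complete E X (p!i)"
  shows "odd (length p)"
  using assms
proof (induction "card X" arbitrary: X p rule: less_induct)
  case less
  note X = less.prems(1-3) and a = less.prems(4) and inner = less.prems(6)
  have fin: "finite X" using X(1) graph finite_subset unfolding graph_def by blast
  have conn: "connected_on X H" using X(3) unfolding anticonnected_def H_def .
  show ?case
  proof (rule ccontr)
    assume "\<not> odd (length p)"
    then have ev: "even (length p)" by simp
    have IH: "odd (path_complete_edges E S p)" if S: "S \<subset> X" "S \<noteq> {}" "connected_on S H" for S
    proof -
      have "card S < card X" using S(1) fin psubset_card_mono by blast
      moreover have "S \<subseteq> V" "anticonnected E S"
        using S X(1) unfolding anticonnected_def H_def by auto
      ultimately have "odd (length q)" if "anchored S q v" "3 \<le> length q"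
        "\<And>i. 0 < i \<Longrightarrow> i + 1 < length q \<Longrightarrow> \<not> complete E S (q!i)" for q
        using less.hyps[of S q] that S(2) by blast
      moreover have "anchored S p v" using anchored_subset[OF a] S(1) by blast
      ultimately show ?thesis using complete_edges_parity_by_gaps[of S v p] ev by blast
    qed
    have "length p = 4 \<or> 6 \<le> length p" using ev less.prems(5) by presburger
    then show False
    proof
      assume "length p = 4"
      then show False
        using no_anchored_path_of_length_three[OF a X(1,3)] inner[of 1] inner[of 2] by simp
    next
      assume len: "6 \<le> length p"
      show False
      proof (cases "\<exists>u\<in>X. \<exists>w\<in>X. u \<noteq> w \<and> \<not> H u w")
        case False
        then have stable: "\<not> E u w" if "u \<in> X" "w \<in> X" for u w
          using that E_irrefl by (cases "u = w") auto
        \<comment> \<open>A stable set is a clique of the complement, so all its nonempty subsets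
          are anticonnected.\<close>
        have "connected_on S H" if "S \<subset> X" "S \<noteq> {}" for S
        proof -
          obtain c where "c \<in> S" using \<open>S \<noteq> {}\<close> by blast
          show ?thesis
            by (rule connected_on_star[OF H_sym \<open>c \<in> S\<close>]) (use stable that \<open>c \<in> S\<close> in auto)
        qed
        then show False
          using no_anchored_path_stable[OF a X(1,2) stable ev _ inner] IH len by simp
      next
        case True
        obtain x y where xy: "x \<in> X" "y \<in> X" "x \<noteq> y" "\<not> H x y"
          "connected_on (X - {x}) H" "connected_on (X - {y}) H"
          and alt: "connected_on (X - {x, y}) H \<or> (\<exists>c\<in>X. H x c \<and> H c y)"
          using separated_non_cut_pair[OF fin conn H_sym H_irrefl True] by blast
        have Exy: "E x y" using xy(3,4) by simp
        have odds: "odd (path_complete_edges E (X - {x}) p)" "odd (path_complete_edges E (X - {y}) p)"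
          using IH[of "X - {x}"] IH[of "X - {y}"] xy by blast+
        show False
        proof (cases "\<exists>c\<in>X. H x c \<and> H c y")
          case True
          then obtain c where c: "c \<in> X" "H x c" "H c y" by blast
          \<comment> \<open>A common nonneighbour \<open>c\<close> gives an antipath with three
            vertices, so \<open>odd_xy\<close> holds by its first alternative and nothing about
            \<open>X - {x, y}\<close> is required.\<close>
          have "is_path X H [y]" using xy(2) by (simp add: is_path_def)
          then have "is_path X H [c, y]"
            by (rule is_path_Cons[OF _ H_sym H_irrefl c(1)]) (use c(3) in simp_all)
          then have "is_path X H [x, c, y]"
            by (rule is_path_Cons[OF _ H_sym H_irrefl xy(1)]) (use c(2,3) xy(3,4) in auto)
          from no_anchored_path_if_antipath[OF a X(1) ev len inner xy(1-3) Exy this _ _ odds]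
          show False by simp
        next
          case False
          then have Z: "connected_on (X - {x, y}) H" using alt by blast
          obtain R where R: "is_path X H R" "hd R = x" "last R = y"
            using induced_path_exists[OF H_sym H_irrefl conn xy(1,2)] by blast
          \<comment> \<open>The adjacent pair alone is not anticonnected; so
            \<open>X - {x, y}\<close> is nonempty and the induction hypothesis applies to
            it.\<close>
          have "X \<noteq> {x, y}"
          proof
            assume eq: "X = {x, y}"
            have "{x} \<noteq> {}" "{x} \<subset> X" using xy by auto
            from connected_on_boundary[OF conn this] show False using eq xy(4) by blast
          qed
          then have "X - {x, y} \<noteq> {}" using xy by blast
          then have "odd (path_complete_edges E (X - {x, y}) p)" using IH[OF _ _ Z] xy by blast
          then show False
            using no_anchored_path_if_antipath[OF a X(1) ev len inner xy(1-3) Exy R odds] by simp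
        qed
      qed
    qed
  qed
qed

section \<open>Parity of the number of complete edges\<close>

text \<open>\<open>W\<close> stands for the vertex set of the ambient path or hole, of which only
  the degree bound matters. \<open>Q\<close> is cut at its \<open>X\<close>-complete vertices. For
  each gap, a complete vertex of \<open>W\<close> other than its two ends is an anchor.\<close>

lemma complete_edges_parity:
  assumes X: "X \<subseteq> V" "X \<noteq> {}" "anticonnected E X"
    and Q: "is_path (V - X) E Q" "complete E X (hd Q)" "complete E X (last Q)"
    and QW: "set Q \<subseteq> W" and W: "W \<subseteq> V" "3 \<le> card {v \<in> W. complete E X v}"
    and deg: "\<And>u a b c. u \<in> W \<Longrightarrow> a \<in> W \<Longrightarrow> b \<in> W \<Longrightarrow> c \<in> W \<Longrightarrow> E u a \<Longrightarrow> E u b \<Longrightarrow> E u c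
      \<Longrightarrow> a = b \<or> a = c \<or> b = c"
  shows "even (path_complete_edges E X Q) \<longleftrightarrow> even (length Q - 1)"
proof -
  let ?T = "\<lambda>k. complete E X (Q!k)"
  let ?n = "length Q - 1"
  note QP = is_pathD[OF Q(1)]
  have "even (card {k. 0 \<le> k \<and> k < ?n \<and> ?T k \<and> ?T (k + 1)}) \<longleftrightarrow> even (?n - 0)"
  proof (rule even_card_by_gaps[where T = ?T])
    show "?T 0" "?T ?n" using Q(2,3) QP(1) by (simp_all add: hd_conv_nth last_conv_nth)
    fix i j assume ij: "i < j" "j \<le> ?n" "?T i" "?T j" and no: "\<And>k. i < k \<Longrightarrow> k < j \<Longrightarrow> \<not> ?T k"
    show "j = i + 1 \<and> ?T i \<and> ?T (i + 1)
        \<or> even (j - i) \<and> (\<forall>k. i \<le> k \<and> k < j \<longrightarrow> \<not> (?T k \<and> ?T (k + 1)))"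
    proof (cases "j = i + 1")
      case True then show ?thesis using ij by simp
    next
      case False
      have j: "i \<le> j" "j < length Q" using ij by linarith+
      let ?q = "slice Q i j"
      have len: "length ?q = Suc j - i" using length_slice[OF j] .
      have "\<not> {v \<in> W. complete E X v} \<subseteq> {Q!i, Q!j}"
      proof
        assume "{v \<in> W. complete E X v} \<subseteq> {Q!i, Q!j}"
        then have "card {v \<in> W. complete E X v} \<le> card {Q!i, Q!j}" by (intro card_mono) auto
        also have "\<dots> \<le> 2" by (simp add: card_insert_if)
        finally show False using W(2) by simp
      qed
      then obtain v where v: "v \<in> W" "complete E X v" "v \<noteq> Q!i" "v \<noteq> Q!j" by blast
      have vQ: "v \<noteq> Q!k" if "i \<le> k" "k \<le> j" for k
      proof (cases "k = i \<or> k = j")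
        case True then show ?thesis using v by blast
      next
        case False
        then show ?thesis using no[of k] that v(2) by auto
      qed
      have inW: "Q!k \<in> W" if "k \<le> j" for k using that j(2) QW by auto
      have "anchored X ?q v"
        unfolding anchored_def
      proof (intro conjI allI impI)
        show "is_path (V - X) E ?q" using is_path_slice[OF Q(1) j] .
        show "complete E X (hd ?q)" "complete E X (last ?q)"
          using ij j by (simp_all add: hd_slice last_slice)
        show "v \<in> V" using v W(1) by blast
        show "v \<notin> set ?q"
        proof
          assume "v \<in> set ?q"
          then obtain k where "i \<le> k" "k \<le> j" "v = Q!k" using set_slice[OF j] by auto
          then show False using vQ[of k] by simp
        qed
        show "complete E X v" using v(2) .
        fix k assume k: "0 < k" "k + 1 < length ?q"
        then have m: "i < i + k" "i + k < j" using len by simp_all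
        \<comment> \<open>An interior vertex of the gap already has two neighbours on
          \<open>Q\<close>, both different from \<open>v\<close>, so by \<open>deg\<close> it is not
          adjacent to \<open>v\<close>.\<close>
        have "E (Q!(i + k)) (Q!(i + k - 1))" "E (Q!(i + k)) (Q!(i + k + 1))"
          using QP(4)[of "i + k" "i + k - 1"] QP(4)[of "i + k" "i + k + 1"] m j(2) by auto
        moreover have "Q!(i + k - 1) \<noteq> Q!(i + k + 1)"
          using QP(2) m j(2) by (simp add: nth_eq_iff_index_eq)
        moreover have "v \<noteq> Q!(i + k - 1)" "v \<noteq> Q!(i + k + 1)"
          using vQ[of "i + k - 1"] vQ[of "i + k + 1"] m by auto
        ultimately have "\<not> E (Q!(i + k)) v"
          using deg[of "Q!(i + k)" "Q!(i + k - 1)" "Q!(i + k + 1)" v]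
            inW[of "i + k"] inW[of "i + k - 1"] inW[of "i + k + 1"] m v(1) by auto
        then show "\<not> E v (?q!k)" using k j E_commute by (simp add: len nth_slice)
      qed
      moreover have "3 \<le> length ?q" using len ij(1) False by linarith
      moreover have "\<not> complete E X (?q!k)" if "0 < k" "k + 1 < length ?q" for k
        using no[of "i + k"] j that by (simp add: len nth_slice)
      ultimately have "odd (length ?q)" using odd_length_if_inner_incomplete[OF X] by blast
      moreover have "\<not> (?T k \<and> ?T (k + 1))" if "i \<le> k" "k < j" for k
        using no[of k] no[of "k + 1"] that False by (cases "k = i") auto
      ultimately show ?thesis using len ij(1) by auto
    qed
  qed simp
  moreover have "{k. 0 \<le> k \<and> k < ?n \<and> ?T k \<and> ?T (k + 1)}
      = {i. i + 1 < length Q \<and> ?T i \<and> ?T (i + 1)}" by auto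
  ultimately show ?thesis unfolding path_complete_edges_def by simp
qed

section \<open>Degrees, arcs and complete edges of holes\<close>

lemma path_degree_le_two:
  assumes P: "is_path W E P" and u: "u \<in> set P" and abc: "a \<in> set P" "b \<in> set P" "c \<in> set P"
    and E: "E u a" "E u b" "E u c"
  shows "a = b \<or> a = c \<or> b = c"
proof -
  note PD = is_pathD[OF P]
  obtain k where k: "k < length P" "u = P!k" using u by (auto simp: in_set_conv_nth)
  have "\<exists>l. a = P!l \<and> (k + 1 = l \<or> l + 1 = k)" if "a \<in> set P" "E u a" for a
    using that PD(4)[OF k(1)] unfolding k(2) by (metis in_set_conv_nth)
  from this[OF abc(1) E(1)] this[OF abc(2) E(2)] this[OF abc(3) E(3)]
  obtain l1 l2 l3 where l: "a = P!l1" "b = P!l2" "c = P!l3"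
    "k + 1 = l1 \<or> l1 + 1 = k" "k + 1 = l2 \<or> l2 + 1 = k" "k + 1 = l3 \<or> l3 + 1 = k" by blast
  from l(4-6) have "l1 = l2 \<or> l1 = l3 \<or> l2 = l3" by linarith
  then show ?thesis unfolding l(1-3) by (elim disjE) simp_all
qed

lemma hole_degree_le_two:
  assumes C: "is_hole W E C" and u: "u \<in> set C" and abc: "a \<in> set C" "b \<in> set C" "c \<in> set C"
    and E: "E u a" "E u b" "E u c"
  shows "a = b \<or> a = c \<or> b = c"
proof -
  let ?n = "length C"
  have adj: "E (C!i) (C!j) \<longleftrightarrow> (j = (i + 1) mod ?n \<or> i = (j + 1) mod ?n)" if "i < ?n" "j < ?n" for i j
    using C that unfolding is_hole_def by blast
  obtain k where k: "k < ?n" "u = C!k" using u by (auto simp: in_set_conv_nth)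
  \<comment> \<open>The cyclic predecessor of \<open>k\<close>.\<close>
  define m where "m = (if k = 0 then ?n - 1 else k - 1)"
  have "a = C!((k + 1) mod ?n) \<or> a = C!m" if a: "a \<in> set C" "E u a" for a
  proof -
    obtain l where l: "l < ?n" "a = C!l" using a(1) by (auto simp: in_set_conv_nth)
    then have "l = (k + 1) mod ?n \<or> k = (l + 1) mod ?n" using adj[OF k(1) l(1)] a(2) k(2) by simp
    moreover have "l = m" if "k = (l + 1) mod ?n"
      using that l(1) unfolding m_def by (cases "l + 1 = ?n") auto
    ultimately show ?thesis using l(2) by blast
  qed
  from this[OF abc(1) E(1)] this[OF abc(2) E(2)] this[OF abc(3) E(3)] show ?thesis by auto
qed

lemma no_triangle_in_hole:
  assumes C: "is_hole W E C" and abc: "a \<in> set C" "b \<in> set C" "c \<in> set C"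
  shows "\<not> (E a b \<and> E b c \<and> E a c)"
proof
  assume E: "E a b \<and> E b c \<and> E a c"
  let ?n = "length C"
  have n: "4 \<le> ?n" using C unfolding is_hole_def by blast
  have adj: "E (C!i) (C!j) \<longleftrightarrow> (j = (i + 1) mod ?n \<or> i = (j + 1) mod ?n)" if "i < ?n" "j < ?n" for i j
    using C that unfolding is_hole_def by blast
  have md: "(i + 1) mod ?n = (if i + 1 = ?n then 0 else i + 1)" if "i < ?n" for i
    using that by (cases "i + 1 = ?n") auto
  obtain i j k where ijk: "i < ?n" "a = C!i" "j < ?n" "b = C!j" "k < ?n" "c = C!k"
    using abc by (auto simp: in_set_conv_nth)
  have "j = (if i + 1 = ?n then 0 else i + 1) \<or> i = (if j + 1 = ?n then 0 else j + 1)"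
    "k = (if j + 1 = ?n then 0 else j + 1) \<or> j = (if k + 1 = ?n then 0 else k + 1)"
    "k = (if i + 1 = ?n then 0 else i + 1) \<or> i = (if k + 1 = ?n then 0 else k + 1)"
    using E adj[of i j] adj[of j k] adj[of i k] ijk md by simp_all
  then show False using n by (auto split: if_splits)
qed

text \<open>The arc starts at position \<open>s\<close> and may wrap around. It omits at least one
  vertex of the hole, so its two ends are not joined by the closing edge.\<close>

lemma is_path_arc:
  assumes C: "is_hole W E C" and m: "0 < m" "m < length C"
  shows "is_path W E (map (\<lambda>k. C!((s + k) mod length C)) [0..<m])"
proof (rule is_pathI)
  let ?n = "length C"
  let ?p = "map (\<lambda>k. C!((s + k) mod ?n)) [0..<m]"
  have n: "4 \<le> ?n" and dist: "distinct C" and sub: "set C \<subseteq> W"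
    using C unfolding is_hole_def by blast+
  have adj: "E (C!i) (C!j) \<longleftrightarrow> (j = (i + 1) mod ?n \<or> i = (j + 1) mod ?n)" if "i < ?n" "j < ?n" for i j
    using C that unfolding is_hole_def by blast
  have lt: "(s + k) mod ?n < ?n" for k by (rule mod_less_divisor) (use n in linarith)
  have inj: "k = l" if "(s + k) mod ?n = (s + l) mod ?n" "k < ?n" "l < ?n" for k l
  proof -
    have *: "l' \<le> k'" if "(s + k') mod ?n = (s + l') mod ?n" "k' < ?n" "l' < ?n" for k' l'
    proof (rule ccontr)
      assume "\<not> ?thesis"
      then have less: "s + k' \<le> s + l'" "0 < l' - k'" "l' - k' < ?n" using that by auto
      then have "?n dvd (s + l') - (s + k')" using that(1) mod_eq_dvd_iff_nat by metis
      then show False using less nat_dvd_not_less[of "l' - k'" ?n] by simp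
    qed
    show ?thesis using *[of k l] *[of l k] that by simp
  qed
  show "?p \<noteq> []" using m by simp
  have "inj_on (\<lambda>k. C!((s + k) mod ?n)) {0..<m}"
  proof (rule inj_onI)
    fix k l assume kl: "k \<in> {0..<m}" "l \<in> {0..<m}" "C!((s + k) mod ?n) = C!((s + l) mod ?n)"
    then have "(s + k) mod ?n = (s + l) mod ?n" using nth_eq_iff_index_eq[OF dist lt lt] by simp
    from inj[OF this] show "k = l" using kl(1,2) m(2) by simp
  qed
  then show "distinct ?p" by (simp add: distinct_map)
  show "set ?p \<subseteq> W" using lt sub by auto
  fix i j assume "i < length ?p" "j < length ?p"
  then have ij: "i < m" "j < m" by simp_all
  have step: "((s + k) mod ?n + 1) mod ?n = (s + (k + 1)) mod ?n" for k by (simp add: mod_simps)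
  \<comment> \<open>The offset \<open>i + 1\<close> may equal \<open>m\<close>, which is still below
    \<open>?n\<close>, so \<open>inj\<close> applies.\<close>
  have "(s + j) mod ?n = (s + (i + 1)) mod ?n \<longleftrightarrow> j = i + 1"
    using inj[of j "i + 1"] ij m by auto
  moreover have "(s + i) mod ?n = (s + (j + 1)) mod ?n \<longleftrightarrow> i = j + 1"
    using inj[of i "j + 1"] ij m by auto
  ultimately show "E (?p!i) (?p!j) \<longleftrightarrow> (i + 1 = j \<or> j + 1 = i)"
    using adj[OF lt[of i] lt[of j]] step[of i] step[of j] ij by auto
qed

text \<open>Indexing edges by absolute positions, read modulo \<open>length C\<close>, allows the
  counts of successive arcs to be added. The arc has \<open>Suc m\<close> vertices and
  \<open>m\<close> edges.\<close>

lemma path_complete_edges_arc: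
  fixes X :: "'a set" and C :: "'a list" and s m :: nat
  defines "T \<equiv> \<lambda>k. complete E X (C!(k mod length C))"
  shows "path_complete_edges E X (map (\<lambda>k. C!((s + k) mod length C)) [0..<Suc m])
    = card {k. s \<le> k \<and> k < s + m \<and> T k \<and> T (k + 1)}"
proof -
  have "{i. i + 1 < Suc m \<and> T (s + i) \<and> T (s + (i + 1))} = {i. i < m \<and> T (s + i) \<and> T (s + i + 1)}" by auto
  moreover have "bij_betw ((+) s) {i. i < m \<and> T (s + i) \<and> T (s + i + 1)}
      {k. s \<le> k \<and> k < s + m \<and> T k \<and> T (k + 1)}"
  proof (rule bij_betw_byWitness[where f' = "\<lambda>k. k - s"])
  qed auto
  moreover have "path_complete_edges E X (map (\<lambda>k. C!((s + k) mod length C)) [0..<Suc m])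
      = card {i. i + 1 < Suc m \<and> T (s + i) \<and> T (s + (i + 1))}"
    unfolding path_complete_edges_def T_def
    by (intro arg_cong[where f = card] Collect_cong) (auto simp del: upt_Suc)
  ultimately show ?thesis by (metis (no_types, lifting) bij_betw_same_card)
qed

text \<open>The count may start at any position: the positions before \<open>s\<close> are shifted
  by a full turn.\<close>

lemma hole_complete_edges_window:
  assumes "length C \<noteq> 0" "s \<le> length C"
  shows "hole_complete_edges E X C
    = card {k. s \<le> k \<and> k < s + length C \<and> complete E X (C!(k mod length C)) \<and> complete E X (C!((k + 1) mod length C))}"
    (is "_ = card ?B")
proof -
  let ?n = "length C"
  let ?A = "{i. i < ?n \<and> complete E X (C!i) \<and> complete E X (C!((i+1) mod ?n))}"
  have "bij_betw (\<lambda>i. if i < s then i + ?n else i) ?A ?B"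
  proof (rule bij_betw_byWitness[where f' = "\<lambda>k. if k < ?n then k else k - ?n"])
    have "(i + ?n + 1) mod ?n = (i + 1) mod ?n" for i
      by (metis add.assoc add.commute mod_add_self2)
    then show "(\<lambda>i. if i < s then i + ?n else i) ` ?A \<subseteq> ?B" using assms by auto
    show "(\<lambda>k. if k < ?n then k else k - ?n) ` ?B \<subseteq> ?A"
    proof (rule image_subsetI)
      fix k assume k: "k \<in> ?B"
      show "(if k < ?n then k else k - ?n) \<in> ?A"
      proof (cases "k < ?n")
        case False
        then obtain i where i: "k = i + ?n" by (metis add.commute le_Suc_ex not_less)
        then have "i < ?n" using k assms by auto
        moreover have "(i + ?n + 1) mod ?n = (i + 1) mod ?n"
          by (metis add.assoc add.commute mod_add_self2)
        ultimately show ?thesis using k i by auto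
      qed (use k in auto)
    qed
  qed (use assms in auto)
  then show ?thesis unfolding hole_complete_edges_def by (simp add: bij_betw_same_card)
qed

text \<open>The nonadjacent vertices \<open>u\<close> and \<open>v\<close> split the hole into two
  paths with complete ends. On each, the number of complete edges has the parity of its length, and
  the two lengths sum to the even length of the hole. Nonadjacency ensures that each arc omits a
  vertex and so is induced.\<close>

lemma even_hole_complete_edges:
  assumes X: "X \<subseteq> V" "X \<noteq> {}" "anticonnected E X" and C: "is_hole (V - X) E C"
    and three: "3 \<le> card {v \<in> set C. complete E X v}"
    and uv: "u \<in> set C" "v \<in> set C" "complete E X u" "complete E X v" "u \<noteq> v" "\<not> E u v"
  shows "even (hole_complete_edges E X C)"
proof -
  let ?n = "length C"
  have n: "4 \<le> ?n" and sub: "set C \<subseteq> V" using C unfolding is_hole_def by auto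
  have adj: "E (C!i) (C!j) \<longleftrightarrow> (j = (i + 1) mod ?n \<or> i = (j + 1) mod ?n)" if "i < ?n" "j < ?n" for i j
    using C that unfolding is_hole_def by blast
  have "is_hole V E C" using C unfolding is_hole_def by blast
  then have even_n: "even ?n" using berge unfolding berge_def by blast
  obtain i j where ij: "i < j" "j < ?n" "complete E X (C!i)" "complete E X (C!j)" "\<not> E (C!i) (C!j)"
  proof -
    obtain k l where kl: "k < ?n" "u = C!k" "l < ?n" "v = C!l" using uv by (auto simp: in_set_conv_nth)
    then have "k \<noteq> l" using uv by blast
    then show ?thesis using that[of k l] that[of l k] kl uv E_commute by (cases "k < l") auto
  qed
  have "j \<noteq> i + 1" using adj[of i j] ij by auto
  have "\<not> (i = 0 \<and> j = ?n - 1)"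
  proof
    assume "i = 0 \<and> j = ?n - 1"
    then have "j + 1 = ?n" "i = 0" using n by linarith+
    then have "(j + 1) mod ?n = i" by simp
    then show False using adj[of i j] ij by simp
  qed
  let ?arc = "\<lambda>s m. map (\<lambda>k. C!((s + k) mod ?n)) [0..<Suc m]"
  let ?G = "\<lambda>k. complete E X (C!(k mod ?n)) \<and> complete E X (C!((k + 1) mod ?n))"
  have arc: "even (card {k. s \<le> k \<and> k < s + m \<and> ?G k}) \<longleftrightarrow> even m"
    if m: "Suc m < ?n" and c: "complete E X (C!(s mod ?n))" "complete E X (C!((s + m) mod ?n))" for s m
  proof -
    have path: "is_path (V - X) E (?arc s m)" using is_path_arc[OF C _ m] by simp
    have h: "complete E X (hd (?arc s m))" using c(1) by (simp add: hd_map del: upt_Suc)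
    have l: "complete E X (last (?arc s m))" using c(2) by simp
    have arc_sub: "set (?arc s m) \<subseteq> set C" using n by (auto intro!: nth_mem mod_less_divisor)
    have "even (path_complete_edges E X (?arc s m)) \<longleftrightarrow> even (length (?arc s m) - 1)"
      by (rule complete_edges_parity[OF X path h l arc_sub sub three hole_degree_le_two[OF C]])
    then show ?thesis unfolding path_complete_edges_arc by simp
  qed
  have "even (card {k. i \<le> k \<and> k < i + (j - i) \<and> ?G k}) \<longleftrightarrow> even (j - i)"
    by (rule arc) (use ij n \<open>\<not> (i = 0 \<and> j = ?n - 1)\<close> in auto)
  moreover have "even (card {k. j \<le> k \<and> k < j + (?n - (j - i)) \<and> ?G k}) \<longleftrightarrow> even (?n - (j - i))"
  proof (rule arc)
    have "j + (?n - (j - i)) = i + ?n" using ij by simp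
    then show "complete E X (C ! ((j + (?n - (j - i))) mod ?n))" using ij by simp
  qed (use ij n \<open>j \<noteq> i + 1\<close> in auto)
  moreover have "even (?n - (j - i)) \<longleftrightarrow> even (j - i)" using even_n ij by auto
  moreover have "hole_complete_edges E X C = card {k. i \<le> k \<and> k < i + ?n \<and> ?G k}"
    by (rule hole_complete_edges_window) (use ij n in auto)
  moreover have "{k. i \<le> k \<and> k < i + ?n \<and> ?G k}
      = {k. i \<le> k \<and> k < i + (j - i) \<and> ?G k} \<union> {k. j \<le> k \<and> k < j + (?n - (j - i)) \<and> ?G k}"
    using ij by (intro set_eqI) auto
  moreover have "card (\<dots>) = card {k. i \<le> k \<and> k < i + (j - i) \<and> ?G k}
      + card {k. j \<le> k \<and> k < j + (?n - (j - i)) \<and> ?G k}"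
    using ij by (intro card_Un_disjoint) auto
  ultimately show ?thesis by simp
qed

text \<open>An odd count provides a complete edge \<open>u\<close>, \<open>v\<close>. Unless these
  are the only complete vertices there is a third one, \<open>w\<close>; as a hole has no triangle,
  \<open>w\<close> is nonadjacent to \<open>u\<close> or to \<open>v\<close>, and that pair makes
  the count even.\<close>

lemma hole_dichotomy:
  assumes X: "X \<subseteq> V" "X \<noteq> {}" "anticonnected E X" and C: "is_hole (V - X) E C"
  shows "even (hole_complete_edges E X C)
    \<or> (\<exists>u v. u \<noteq> v \<and> {w \<in> set C. complete E X w} = {u, v} \<and> E u v)"
proof (rule ccontr)
  assume no: "\<not> ?thesis"
  let ?n = "length C"
  let ?W = "{w \<in> set C. complete E X w}"
  have n: "4 \<le> ?n" using C unfolding is_hole_def by blast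
  have "{i. i < ?n \<and> complete E X (C!i) \<and> complete E X (C!((i+1) mod ?n))} \<noteq> {}"
    using no unfolding hole_complete_edges_def by (metis card.empty even_zero)
  then obtain i where i: "i < ?n" "complete E X (C!i)" "complete E X (C!((i+1) mod ?n))" by blast
  define u v where "u = C!i" and "v = C!((i+1) mod ?n)"
  have "(i + 1) mod ?n < ?n" by (rule mod_less_divisor) (use n in linarith)
  then have uv: "u \<in> ?W" "v \<in> ?W" "E u v"
    using i C unfolding u_def v_def is_hole_def by auto
  then have "u \<noteq> v" using E_irrefl by blast
  then have "?W \<noteq> {u, v}" using no uv(3) by blast
  then obtain w where w: "w \<in> ?W" "w \<noteq> u" "w \<noteq> v" using uv by blast
  have "card {u, v, w} \<le> card ?W" by (intro card_mono) (use uv w in auto)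
  then have three: "3 \<le> card ?W" using \<open>u \<noteq> v\<close> w by simp
  have "\<not> E u w \<or> \<not> E v w" using no_triangle_in_hole[OF C, of u v w] uv w by blast
  then have "even (hole_complete_edges E X C)"
    using even_hole_complete_edges[OF X C three, of u w] even_hole_complete_edges[OF X C three, of v w] uv w
    by blast
  then show False using no by blast
qed

end

theorem theorem2p3:
  fixes V X :: "'a set" and E :: "'a \<Rightarrow> 'a \<Rightarrow> bool"
  assumes "graph V E" and "berge V E"
    and "X \<subseteq> V" and "X \<noteq> {}" and "anticonnected E X"
  shows "(\<forall>P Q. (is_path (V - X) E P \<or> is_hole (V - X) E P)
              \<and> card {v \<in> set P. complete E X v} \<ge> 3
              \<and> is_path V E Q \<and> set Q \<subseteq> set P
              \<and> complete E X (hd Q) \<and> complete E X (last Q)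
            \<longrightarrow> (even (path_complete_edges E X Q) \<longleftrightarrow> even (length Q - 1)))
       \<and> (\<forall>C. is_hole (V - X) E C \<longrightarrow>
            even (hole_complete_edges E X C)
            \<or> (\<exists>u v. u \<noteq> v \<and> {w \<in> set C. complete E X w} = {u, v} \<and> E u v))"
proof -
  interpret berge_graph V E using assms(1,2) by unfold_locales
  note X = assms(3-5)
  have "even (path_complete_edges E X Q) \<longleftrightarrow> even (length Q - 1)"
    if P: "is_path (V - X) E P \<or> is_hole (V - X) E P" and three: "3 \<le> card {v \<in> set P. complete E X v}"
      and Q: "is_path V E Q" "set Q \<subseteq> set P" "complete E X (hd Q)" "complete E X (last Q)" for P Q
  \<comment> \<open>With \<open>set P\<close> as \<open>W\<close>, paths and holes differ only in
    the proof of the degree bound.\<close>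
  proof (rule complete_edges_parity[OF X _ Q(3,4) Q(2) _ three])
    have sub: "set P \<subseteq> V - X" using P unfolding is_path_def is_hole_def by blast
    then show "set P \<subseteq> V" by blast
    show "is_path (V - X) E Q" using is_path_mono[OF Q(1)] Q(2) sub by blast
    show "a = b \<or> a = c \<or> b = c"
      if "u \<in> set P" "a \<in> set P" "b \<in> set P" "c \<in> set P" "E u a" "E u b" "E u c" for u a b c
      using P path_degree_le_two[OF _ that] hole_degree_le_two[OF _ that] by blast
  qed
  then show ?thesis using hole_dichotomy[OF X] by blast
qed

end
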